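(* Assume $d\ge 3$ and $\mathbb{E}[V(0)]=+\infty$. For any $\varepsilon>0$, there exists $C>0$ such that for any $\beta>0$ small enough and any $n\in\mathbb{N}$ with $n\ell\in\mathbb{Z}^d$, $$\mathbb{E}[g_\beta(0,n\ell)]\le C\exp\left(-(1-\varepsilon)\sqrt{2d\,\overline{\mathfrak{I}}_\beta}\;n\right).$$
   Context: $(S_k)_{k\in\mathbb{N}}$ is the simple random walk on $\mathbb{Z}^d$, with law $\mathbf{P}_x$ and expectation $\mathbf{E}_x$ when started at $x$. Independently, $(V(x))_{x\in\mathbb{Z}^d}$ are i.i.d. with law $\mu$ on $[0,+\infty)$, with joint law $\mathbb{P}$ and expectation $\mathbb{E}$. $\ell\in\mathbb{R}^d$ is a fixed vector of unit Euclidean norm. For $\beta>0$ let $V_\beta(x)=\beta^{-1}\log(\beta V(x)+1)$, let $\mu_\beta$ be the law of $V_\beta(0)$, and $$g_\beta(x,y)=\sum_{n=0}^{+\infty}\mathbf{E}_x\left[\exp\left(-\sum_{k=0}^{n}\beta V_\beta(S_k)\right)\mathbf{1}_{S_n=y}\right],$$ which is the Green function of $H_\beta=-\triangle+\beta V$, where $\triangle f(x)=\frac1{2d}\sum_{y\sim x}(f(y)-f(x))$ (i.e. $g_\beta(\cdot,y)=H_\beta^{-1}\delta_y$). Let $q_d=\mathbf{P}_0[\forall n\ge1,\ S_n\ne0]$, $f(z)=q_d\frac{1-e^{-z}}{1-(1-q_d)e^{-z}}$, and $$\overline{\mathfrak{I}}_\beta=\int f(\beta z)\,\mathrm{d}\mu_\beta(z)=\int\left(\frac1{q_d}+\frac1{\beta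 z}\right)^{-1}\mathrm{d}\mu(z)$$ (the last integrand being $0$ at $z=0$). *)

theory Defs
  imports "HOL-Probability.Probability"
begin

text \<open>
  The lattice is \<^typ>\<open>int ^ 'd\<close>, of dimension CARD('d). Random walk paths
  are functions \<^typ>\<open>nat \<Rightarrow> int ^ 'd\<close>.
\<close>

definition unit_steps :: "(int ^ 'd::finite) set" where
  "unit_steps = {axis i s | i s. s \<in> {1, -1}}"

definition srw_law :: "int ^ 'd::finite \<Rightarrow> (nat \<Rightarrow> int ^ 'd) measure" where
  "srw_law x =
     distr (PiM UNIV (\<lambda>_::nat. measure_pmf (pmf_of_set unit_steps)))
       (PiM UNIV (\<lambda>_::nat. count_space UNIV))
       (\<lambda>\<xi> n. x + (\<Sum>i<n. \<xi> i))"

lemma unit_steps_eq_image: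
  "(unit_steps :: (int ^ 'd::finite) set) = (\<lambda>(i, s). axis i s) ` (UNIV \<times> {1, -1})"
  by (auto simp: unit_steps_def)

lemma finite_unit_steps: "finite (unit_steps :: (int ^ 'd::finite) set)"
  unfolding unit_steps_eq_image by (intro finite_imageI finite_cartesian_product) auto

lemma unit_steps_nonempty: "(unit_steps :: (int ^ 'd::finite) set) \<noteq> {}"
  by (auto simp: unit_steps_def)

lemma card_unit_steps: "card (unit_steps :: (int ^ 'd::finite) set) = 2 * CARD('d)"
proof -
  have "inj_on (\<lambda>(i, s). axis i s :: int ^ 'd) (UNIV \<times> {1, -1})"
    by (auto simp: inj_on_def axis_eq_axis)
  then have "card (unit_steps :: (int ^ 'd) set) = card ((UNIV :: 'd set) \<times> {1, -1 :: int})"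
    unfolding unit_steps_eq_image by (rule card_image)
  then show ?thesis
    unfolding card_cartesian_product by simp
qed

lemma prob_space_srw_law: "prob_space (srw_law (x :: int ^ 'd::finite))"
proof -
  have [measurable]: "(\<lambda>\<xi>. x + (\<Sum>i<n. \<xi> i)) \<in>
      measurable (PiM UNIV (\<lambda>_::nat. measure_pmf (pmf_of_set unit_steps)))
        (count_space (UNIV :: (int ^ 'd) set))" for n
  proof (induction n)
    case (Suc n)
    let ?P = "PiM UNIV (\<lambda>_::nat. measure_pmf (pmf_of_set (unit_steps :: (int ^ 'd) set)))"
    have 1: "(\<lambda>\<xi>. \<xi> n) \<in> measurable ?P (count_space UNIV)"
      using measurable_component_singleton[of n UNIV "\<lambda>_. measure_pmf (pmf_of_set unit_steps)"]
      by (simp cong: measurable_cong_sets)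
    have "(\<lambda>\<xi>. (x + (\<Sum>i<n. \<xi> i)) + \<xi> n) \<in> measurable ?P (count_space UNIV)"
      using measurable_compose_countable[OF _ Suc,
          where f = "\<lambda>a \<xi>. a + \<xi> n"] measurable_compose[OF 1] by auto
    then show ?case by (simp add: add.assoc)
  qed simp
  interpret P: product_prob_space "\<lambda>_::nat. measure_pmf (pmf_of_set (unit_steps :: (int ^ 'd) set))" UNIV
    by unfold_locales
  show ?thesis
    unfolding srw_law_def
    by (rule P.prob_space_distr, rule measurable_PiM_single') auto
qed

definition escape_prob :: "'d::finite itself \<Rightarrow> real" where
  "escape_prob _ =
     measure (srw_law (0 :: int ^ 'd)) {S \<in> space (srw_law 0). \<forall>n\<ge>1. S n \<noteq> 0}"

definition V_beta :: "real \<Rightarrow> real \<Rightarrow> real" where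
  "V_beta \<beta> v = ln (\<beta> * v + 1) / \<beta>"

definition mu_beta :: "real \<Rightarrow> real measure \<Rightarrow> real measure" where
  "mu_beta \<beta> \<mu> = distr \<mu> borel (V_beta \<beta>)"

text \<open>
  The Green function in a frozen environment \<^term>\<open>v\<close>. It takes values in
  \<^typ>\<open>ennreal\<close>, so that the sum over \<^term>\<open>n\<close> is meaningful without a prior
  proof of convergence.
\<close>
definition green :: "real \<Rightarrow> (int ^ 'd::finite \<Rightarrow> real) \<Rightarrow> int ^ 'd \<Rightarrow> int ^ 'd \<Rightarrow> ennreal" where
  "green \<beta> v x y =
     (\<Sum>n. \<integral>\<^sup>+ S. ennreal (exp (- (\<Sum>k=0..n. \<beta> * V_beta \<beta> (v (S k)))))
                    * indicator {S. S n = y} S \<partial>srw_law x)"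

definition f_escape :: "real \<Rightarrow> real \<Rightarrow> real" where
  "f_escape q z = q * (1 - exp (- z)) / (1 - (1 - q) * exp (- z))"

definition I_bar :: "'d::finite itself \<Rightarrow> real measure \<Rightarrow> real \<Rightarrow> real" where
  "I_bar D \<mu> \<beta> = (\<integral>z. f_escape (escape_prob D) (\<beta> * z) \<partial>mu_beta \<beta> \<mu>)"

text \<open>
  The second expression for \<^const>\<open>I_bar\<close>. The case distinction is needed
  because \<^term>\<open>1 / 0 = (0 :: real)\<close>.
\<close>
lemma I_bar_alt:
  assumes "sets \<mu> = sets borel" "AE z in \<mu>. 0 \<le> z" "\<beta> > 0" "escape_prob D > 0"
  shows "I_bar D \<mu> \<beta> =
    (\<integral>z. (if z = 0 then 0 else inverse (1 / escape_prob D + 1 / (\<beta> * z))) \<partial>\<mu>)"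
proof -
  let ?q = "escape_prob D"
  have [measurable]: "V_beta \<beta> \<in> borel_measurable \<mu>"
    "f_escape ?q \<in> borel_measurable borel"
    using assms(1) unfolding V_beta_def[abs_def] f_escape_def[abs_def]
    by (simp_all cong: measurable_cong_sets)
  have [measurable]: "(\<lambda>z. z) \<in> borel_measurable \<mu>"
    using assms(1) by (simp cong: measurable_cong_sets)
  have eq: "f_escape ?q (\<beta> * V_beta \<beta> z) =
      (if z = 0 then 0 else inverse (1 / ?q + 1 / (\<beta> * z)))" if "0 \<le> z" for z
  proof (cases "z = 0")
    case False
    with that assms(3) have p: "\<beta> * z > 0" by simp
    have e: "exp (- (\<beta> * V_beta \<beta> z)) = 1 / (\<beta> * z + 1)"
      using p assms(3) by (simp add: V_beta_def exp_minus inverse_eq_divide)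
    have "1 - (1 - ?q) * (1 / (\<beta> * z + 1)) = (\<beta> * z + ?q) / (\<beta> * z + 1)"
      "1 - 1 / (\<beta> * z + 1) = \<beta> * z / (\<beta> * z + 1)"
      using p by (simp_all add: field_simps)
    moreover have "1 / ?q + 1 / (\<beta> * z) = (\<beta> * z + ?q) / (?q * (\<beta> * z))"
      using p assms(4) by (simp only: add_frac_eq[OF less_imp_neq[OF assms(4), symmetric] less_imp_neq[OF p, symmetric]]) simp
    ultimately show ?thesis
      using p False by (simp add: f_escape_def e)
  qed (simp add: f_escape_def V_beta_def)
  have "I_bar D \<mu> \<beta> = (\<integral>z. f_escape ?q (\<beta> * V_beta \<beta> z) \<partial>\<mu>)"
    unfolding I_bar_def mu_beta_def by (rule integral_distr) measurable
  also have "\<dots> = (\<integral>z. (if z = 0 then 0 else inverse (1 / ?q + 1 / (\<beta> * z))) \<partial>\<mu>)"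
    using assms(2) by (intro integral_cong_AE) (auto elim!: eventually_mono simp: eq)
  finally show ?thesis .
qed

definition lattice_vec :: "int ^ 'd::finite \<Rightarrow> real ^ 'd" where
  "lattice_vec y = (\<chi> i. real_of_int (y $ i))"

end

theory Submission
  imports Defs
begin

text \<open>
  Put \<open>s(z) = 1 / (1 + \<beta> z)\<close>, so that a visit to a site of potential \<open>z\<close> is survived with probability
  \<open>s(z) = exp (- \<beta> V\<^sub>\<beta>(z))\<close>, and \<open>\<phi>(k) = \<integral> s\<^sup>k d\<mu>\<close>. By independence, integrating out the environment
  gives every path of the walk the weight \<open>\<Prod>\<^sub>x \<phi>(local time at x)\<close>, and the averaged Green function is at
  most \<open>G(0,0)\<close> times the total weight of the paths stopped at the first visit to the target
  (\<^verbatim>\<open>expected_green_le\<close>). Write \<open>I\<close> for \<open>I_bar\<close>; it tends to 0 with \<open>\<beta>\<close>.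

  The key point is that on a block of \<open>T = \<delta> / I\<close> steps the killing is so small that a first moment
  determines it. Let \<open>X = \<Sum>\<^sub>x (1 - \<phi>(local time at x))\<close>. Always \<open>X \<le> T I / q = O(\<delta>)\<close>, since
  \<open>1 - s\<^sup>k \<le> k (1 - s)\<close> and \<open>\<integral> (1 - s) d\<mu> \<le> I / q\<close>; hence the weight of the block is \<open>1 - X + O(\<delta>\<^sup>2)\<close>.
  In the mean, \<open>X\<close> is at least \<open>T I\<close>: the sum \<open>\<Sum>\<^sub>x (1 - s\<^bsup>L(x)\<^esup>)\<close> charges each visit
  with \<open>(1 - s) s\<^sup>R\<close>, where \<open>R\<close> counts the later visits to the same site, and \<open>R\<close> is dominated by a
  geometric variable of parameter \<open>q\<close> (\<^verbatim>\<open>walkE_return\<close>, \<^verbatim>\<open>walkE_killed_lower\<close>). On the other side, the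
  function \<open>cosh (a r)\<close> of the coordinate \<open>r\<close> along \<open>l\<close> grows in the mean by a factor of about
  \<open>1 + a\<^sup>2 T / 2d\<close> in \<open>T\<close> steps. For \<open>a\<close> slightly below \<open>sqrt (2 d I)\<close> the killing wins, and weight times
  \<open>cosh\<close> is a supermartingale along blocks (\<^verbatim>\<open>block_estimate\<close>, \<^verbatim>\<open>block_factor_bound\<close>).

  Since \<open>\<phi>(j + k) \<ge> \<phi>(j) \<phi>(k)\<close>, the weight of a path is not bounded by the product of the weights of its
  blocks; each block may charge only sites that no earlier block has charged. Space is therefore cut
  into slabs of width of order \<open>I\<^bsup>-1/2\<^esup>\<close> orthogonal to \<open>l\<close>. Different slabs charge different sites, and in
  one slab a number \<open>J\<close> of blocks, bounded independently of \<open>\<beta>\<close>, is enough. They charge \<open>J T\<close> sites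
  at most, and a walk of \<open>T\<close> steps spends only \<open>o(T)\<close> time in a set of \<open>J T\<close> sites because the Green
  function vanishes at infinity. So crossing a slab costs a fixed factor \<open>1 / \<rho>\<close>, once for each
  slab between 0 and the target, which gives the claim (\<^verbatim>\<open>survive_slabs\<close>, \<^verbatim>\<open>survive_decay\<close>).

  Transience enters only through a positive function \<open>g\<close> that vanishes at infinity and satisfies
  \<open>g - P g \<ge> 1\<close> at 0 and \<open>g - P g \<ge> 0\<close> elsewhere, for the transition operator \<open>P\<close> of the walk; a multiple
  of \<open>(|x|\<^sup>2 + K)\<^bsup>-1/4\<^esup>\<close> is one for \<open>d \<ge> 3\<close>
  (\<^verbatim>\<open>green_majorant_exists\<close>). It bounds the Green function, the hitting probabilities and \<open>1 / q\<close>.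
\<close>

section \<open>Averages over one step of the walk\<close>

definition step_avg :: "(int ^ 'd::finite \<Rightarrow> real) \<Rightarrow> real" where
  "step_avg g = (\<Sum>e\<in>unit_steps. g e) / (2 * real CARD('d))"

lemma sum_unit_steps:
  "(\<Sum>e\<in>(unit_steps :: (int ^ 'd::finite) set). g e) = (\<Sum>i\<in>UNIV. g (axis i 1) + g (axis i (-1)))"
proof -
  have "inj_on (\<lambda>(i, s). axis i s :: int ^ 'd) (UNIV \<times> {1, -1})"
    by (auto simp: inj_on_def axis_eq_axis)
  then have "(\<Sum>e\<in>(unit_steps :: (int ^ 'd) set). g e)
      = (\<Sum>(i,s)\<in>(UNIV :: 'd set) \<times> {1, -1}. g (axis i s))"
    unfolding unit_steps_eq_image by (subst sum.reindex) (auto intro!: sum.cong)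
  also have "\<dots> = (\<Sum>i\<in>UNIV. \<Sum>s\<in>{1, -1}. g (axis i s))"
    by (rule sum.cartesian_product[symmetric])
  finally show ?thesis by (simp add: add.commute)
qed

lemma step_avg_const [simp]: "step_avg (\<lambda>e :: int ^ 'd::finite. c) = c"
  by (simp add: step_avg_def card_unit_steps)

lemma step_avg_mono:
  assumes "\<And>e. e \<in> unit_steps \<Longrightarrow> f e \<le> g e"
  shows "step_avg f \<le> step_avg g"
  unfolding step_avg_def by (intro divide_right_mono sum_mono assms) auto

lemma step_avg_nonneg:
  assumes "\<And>e. e \<in> unit_steps \<Longrightarrow> 0 \<le> f e"
  shows "0 \<le> step_avg f"
  unfolding step_avg_def by (intro divide_nonneg_nonneg sum_nonneg assms) auto

lemma step_avg_cong:
  assumes "\<And>e. e \<in> unit_steps \<Longrightarrow> f e = g e"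
  shows "step_avg f = step_avg g"
  unfolding step_avg_def using assms by simp

lemma step_avg_add: "step_avg (\<lambda>e. f e + g e) = step_avg f + step_avg g"
  by (simp add: step_avg_def sum.distrib add_divide_distrib)

lemma step_avg_diff: "step_avg (\<lambda>e. f e - g e) = step_avg f - step_avg g"
  by (simp add: step_avg_def sum_subtractf diff_divide_distrib)

lemma step_avg_cmult: "step_avg (\<lambda>e. c * f e) = c * step_avg f"
  by (simp add: step_avg_def sum_distrib_left[symmetric])

definition level :: "real ^ 'd::finite \<Rightarrow> int ^ 'd \<Rightarrow> real" where
  "level l x = l \<bullet> lattice_vec x"

lemma lattice_vec_add: "lattice_vec (x + y) = lattice_vec x + lattice_vec y"
  by (simp add: lattice_vec_def vec_eq_iff)

lemma lattice_vec_axis: "lattice_vec (axis i s) = axis i (real_of_int s)"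
  by (auto simp: lattice_vec_def vec_eq_iff axis_def)

lemma level_add: "level l (x + y) = level l x + level l y"
  by (simp add: level_def lattice_vec_add inner_add_right)

lemma level_axis: "level l (axis i s) = l $ i * real_of_int s"
  by (simp add: level_def lattice_vec_axis inner_axis)

lemma abs_level_step:
  assumes "norm l = 1" "e \<in> unit_steps"
  shows "\<bar>level l e\<bar> \<le> 1"
proof -
  obtain i s where "e = axis i s" "s \<in> {1, -1}" using assms(2) by (auto simp: unit_steps_def)
  then show ?thesis using component_le_norm_cart[of l i] assms(1) by (auto simp: level_axis)
qed

lemma sum_component_squares: "norm (l :: real ^ 'd::finite) = 1 \<Longrightarrow> (\<Sum>i\<in>UNIV. (l $ i)\<^sup>2) = 1"
  unfolding norm_eq_1 inner_vec_def by (simp add: power2_eq_square)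

lemma step_avg_level_linear: "step_avg (\<lambda>e. level l e * c) = 0"
  by (simp add: step_avg_def sum_unit_steps level_axis sum_distrib_right[symmetric])

lemma step_avg_level_square:
  fixes l :: "real ^ 'd::finite"
  assumes "norm l = 1"
  shows "step_avg (\<lambda>e. (level l e)\<^sup>2) = 1 / real CARD('d)"
  using sum_component_squares[OF assms]
  by (simp add: step_avg_def sum_unit_steps level_axis sum_distrib_left[symmetric])

lemma cosh_le_quadratic:
  fixes u :: real assumes "\<bar>u\<bar> \<le> v"
  shows "cosh u \<le> 1 + u\<^sup>2 / 2 * cosh v"
proof -
  have d: "\<forall>m x. (0::nat) \<le> m \<longrightarrow> ((\<lambda>x. if even m then cosh x else sinh x) has_real_derivative
      (if even (Suc m) then cosh x else sinh x)) (at x)"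
    by (auto intro!: derivative_eq_intros)
  obtain t where t: "\<bar>t\<bar> \<le> \<bar>u\<bar>"
    "cosh u = (\<Sum>m<2. (if even m then cosh 0 else sinh 0) / fact m * u ^ m) + (if even (2::nat) then cosh t else sinh t) / fact 2 * u\<^sup>2"
    using Maclaurin_all_le[of "\<lambda>m x. if even m then cosh x else sinh x" cosh u 2] d
    by auto
  have "cosh \<bar>t\<bar> \<le> cosh v" using t(1) assms
    by (subst cosh_real_nonneg_le_iff) auto
  then have "cosh t * (u\<^sup>2 / 2) \<le> cosh v * (u\<^sup>2 / 2)" by (intro mult_right_mono) auto
  with t(2) show ?thesis by (simp add: numeral_2_eq_2 mult.commute)
qed

lemma step_avg_cosh_level:
  fixes l :: "real ^ 'd::finite"
  assumes "norm l = 1" "0 \<le> \<kappa>"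
  shows "step_avg (\<lambda>e. cosh (\<kappa> * level l e)) \<le> 1 + \<kappa>\<^sup>2 / (2 * real CARD('d)) * cosh \<kappa>"
proof -
  have "step_avg (\<lambda>e. cosh (\<kappa> * level l e)) \<le> step_avg (\<lambda>e. 1 + (\<kappa>\<^sup>2 / 2 * cosh \<kappa>) * (level l e)\<^sup>2)"
  proof (rule step_avg_mono)
    fix e assume "e \<in> (unit_steps :: (int ^ 'd) set)"
    then have "\<bar>\<kappa> * level l e\<bar> \<le> \<kappa>"
      using abs_level_step[OF assms(1)] assms(2) by (simp add: abs_mult mult_left_le)
    from cosh_le_quadratic[OF this]
    show "cosh (\<kappa> * level l e) \<le> 1 + (\<kappa>\<^sup>2 / 2 * cosh \<kappa>) * (level l e)\<^sup>2"
      by (simp add: power_mult_distrib mult.assoc mult.left_commute mult.commute)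
  qed
  also have "\<dots> = 1 + \<kappa>\<^sup>2 / (2 * real CARD('d)) * cosh \<kappa>"
    by (simp only: step_avg_add step_avg_cmult step_avg_const step_avg_level_square[OF assms(1)]) simp
  finally show ?thesis .
qed

section \<open>A growth function with a flat part\<close>

text \<open>
  Growth at rate \<open>a\<close> to the right of 0, constant to the left. In one slab it is anchored a margin above
  the lower boundary, because near and below that boundary nothing is charged: the walk may return there
  for free, so the function must not gain there.
\<close>

definition ramp :: "real \<Rightarrow> real \<Rightarrow> real" where
  "ramp \<kappa> t = cosh (\<kappa> * max 0 t)"

lemma ramp_ge_1: "1 \<le> ramp \<kappa> t"
  by (simp add: ramp_def cosh_real_ge_1)

lemma ramp_nonpos: "t \<le> 0 \<Longrightarrow> ramp \<kappa> t = 1"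
  by (simp add: ramp_def max_def)

lemma ramp_mono: "0 \<le> \<kappa> \<Longrightarrow> t \<le> t' \<Longrightarrow> ramp \<kappa> t \<le> ramp \<kappa> t'"
  unfolding ramp_def by (subst cosh_real_nonneg_le_iff) (auto intro!: mult_left_mono)

lemma cosh_le_exp_mult:
  fixes a b :: real
  shows "cosh a \<le> exp \<bar>a - b\<bar> * cosh b"
proof -
  have "exp a \<le> exp \<bar>a - b\<bar> * exp b" "exp (-a) \<le> exp \<bar>a - b\<bar> * exp (-b)"
    by (simp_all add: exp_add[symmetric])
  then show ?thesis by (simp add: cosh_field_def distrib_left)
qed

lemma ramp_lower:
  assumes "0 \<le> \<kappa>"
  shows "ramp \<kappa> t * (1 - \<kappa> * \<bar>t' - t\<bar>) \<le> ramp \<kappa> t'"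
proof -
  have 1: "\<bar>\<kappa> * max 0 t - \<kappa> * max 0 t'\<bar> \<le> \<kappa> * \<bar>t' - t\<bar>"
    using assms by (subst right_diff_distrib[symmetric]) (auto simp: abs_mult intro!: mult_left_mono)
  have "ramp \<kappa> t \<le> exp (\<kappa> * \<bar>t' - t\<bar>) * ramp \<kappa> t'"
    unfolding ramp_def
    by (rule order_trans[OF cosh_le_exp_mult[of _ "\<kappa> * max 0 t'"]]) (intro mult_right_mono, use 1 in auto)
  then have "ramp \<kappa> t * exp (- (\<kappa> * \<bar>t' - t\<bar>)) \<le> ramp \<kappa> t'"
    by (simp add: exp_minus field_simps)
  moreover have "1 - \<kappa> * \<bar>t' - t\<bar> \<le> exp (- (\<kappa> * \<bar>t' - t\<bar>))"
    using exp_ge_add_one_self[of "- (\<kappa> * \<bar>t' - t\<bar>)"] by simp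
  ultimately show ?thesis
    using ramp_ge_1[of \<kappa> t] by (meson mult_left_mono order_trans zero_le_one)
qed

lemma step_avg_ramp:
  fixes l :: "real ^ 'd::finite"
  assumes "norm l = 1" "0 \<le> \<kappa>"
  shows "step_avg (\<lambda>e. ramp \<kappa> (t + level l e)) \<le> (1 + \<kappa>\<^sup>2 / (2 * real CARD('d)) * cosh \<kappa>) * ramp \<kappa> t"
proof (cases "t \<le> 0")
  case True
  have "step_avg (\<lambda>e. ramp \<kappa> (t + level l e)) \<le> step_avg (\<lambda>e. cosh (\<kappa> * level l e))"
  proof (rule step_avg_mono)
    fix e :: "int ^ 'd"
    have "\<kappa> * max 0 (t + level l e) \<le> \<kappa> * \<bar>level l e\<bar>"
      using True assms(2) by (intro mult_left_mono) auto
    then have "ramp \<kappa> (t + level l e) \<le> cosh (\<kappa> * \<bar>level l e\<bar>)"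
      unfolding ramp_def using assms(2) by (subst cosh_real_nonneg_le_iff) auto
    also have "\<dots> = cosh (\<kappa> * level l e)" using assms(2)
      by (metis abs_mult abs_of_nonneg cosh_real_abs)
    finally show "ramp \<kappa> (t + level l e) \<le> cosh (\<kappa> * level l e)" .
  qed
  also note step_avg_cosh_level[OF assms]
  finally show ?thesis using True by (simp add: ramp_nonpos)
next
  case False
  have "step_avg (\<lambda>e. ramp \<kappa> (t + level l e)) \<le>
    step_avg (\<lambda>e. cosh (\<kappa> * t) * cosh (\<kappa> * level l e) + level l e * 0 + sinh (\<kappa> * t) * sinh (\<kappa> * level l e))"
  proof (rule step_avg_mono)
    fix e :: "int ^ 'd"
    have "\<kappa> * max 0 (t + level l e) \<le> \<bar>\<kappa> * (t + level l e)\<bar>"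
      using assms(2) by (auto simp: max_def)
    then have "ramp \<kappa> (t + level l e) \<le> cosh (\<bar>\<kappa> * (t + level l e)\<bar>)"
      unfolding ramp_def using assms(2) by (subst cosh_real_nonneg_le_iff) auto
    also have "\<dots> = cosh (\<kappa> * t + \<kappa> * level l e)"
      by (simp add: distrib_left)
    finally show "ramp \<kappa> (t + level l e) \<le> cosh (\<kappa> * t) * cosh (\<kappa> * level l e) + level l e * 0 + sinh (\<kappa> * t) * sinh (\<kappa> * level l e)"
      by (simp add: cosh_add)
  qed
  also have "\<dots> = cosh (\<kappa> * t) * step_avg (\<lambda>e. cosh (\<kappa> * level l e)) + sinh (\<kappa> * t) * step_avg (\<lambda>e. sinh (\<kappa> * level l e))"
    by (simp add: step_avg_add step_avg_cmult)
  also have "step_avg (\<lambda>e. sinh (\<kappa> * level l e)) = 0"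
    by (simp add: step_avg_def sum_unit_steps level_axis)
  also have "cosh (\<kappa> * t) * step_avg (\<lambda>e. cosh (\<kappa> * level l e)) + sinh (\<kappa> * t) * 0
     \<le> cosh (\<kappa> * t) * (1 + \<kappa>\<^sup>2 / (2 * real CARD('d)) * cosh \<kappa>)"
    using step_avg_cosh_level[OF assms] by (simp add: cosh_real_nonneg)
  finally show ?thesis using False by (simp add: ramp_def mult.commute)
qed

text \<open>
  The passage from one slab to the next: a walk that leaves a slab of width \<open>L\<close> through the top, possibly
  jumping far beyond it, has gained a factor \<open>cosh (a v)\<close> over the function anchored at the next slab.
\<close>

lemma ramp_superadditive:
  assumes "0 \<le> \<kappa>" "0 \<le> v" "v \<le> L" "v - L \<le> t"
  shows "cosh (\<kappa> * v) * ramp \<kappa> t \<le> ramp \<kappa> (t + L)"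
proof (cases "t \<le> 0")
  case True
  have "cosh (\<kappa> * v) = ramp \<kappa> v" using assms by (simp add: ramp_def)
  also have "\<dots> \<le> ramp \<kappa> (t + L)" using assms by (intro ramp_mono) auto
  finally show ?thesis using True by (simp add: ramp_nonpos)
next
  case False
  have "cosh (\<kappa> * v) * cosh (\<kappa> * t) \<le> cosh (\<kappa> * L) * cosh (\<kappa> * t)"
    using assms by (intro mult_right_mono) (auto simp: cosh_real_nonneg_le_iff mult_left_mono cosh_real_nonneg)
  also have "\<dots> \<le> cosh (\<kappa> * t + \<kappa> * L)"
    using assms False by (simp add: cosh_add mult.commute)
  finally show ?thesis using False assms by (simp add: ramp_def distrib_left)
qed

section \<open>A function dominating the Green function\<close>

definition sq_norm :: "int ^ 'd::finite \<Rightarrow> real" where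
  "sq_norm x = (\<Sum>i\<in>UNIV. (real_of_int (x $ i))\<^sup>2)"

lemma sq_norm_nonneg: "0 \<le> sq_norm x"
  by (simp add: sq_norm_def sum_nonneg)

lemma component_le_sq_norm: "(real_of_int (x $ i))\<^sup>2 \<le> sq_norm x"
  unfolding sq_norm_def by (rule member_le_sum) auto

lemma sq_norm_step: "sq_norm (x + axis i s) = sq_norm x + (2 * real_of_int (x $ i) * real_of_int s + (real_of_int s)\<^sup>2)"
proof -
  have "sq_norm (x + axis i s) = (\<Sum>j\<in>UNIV. (real_of_int (x $ j))\<^sup>2 +
      (if j = i then 2 * real_of_int (x $ i) * real_of_int s + (real_of_int s)\<^sup>2 else 0))"
    unfolding sq_norm_def by (intro sum.cong refl) (auto simp: axis_def power2_sum)
  then show ?thesis by (simp add: sum.distrib sq_norm_def)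
qed

text \<open>
  The second-order Taylor coefficient at 0 is \<open>5/32\<close>. Increasing it to \<open>6/32\<close> leaves room for the higher
  orders, and \<open>6/32\<close> is still what superharmonicity in dimension 3 tolerates. After raising to the fourth
  power the claim is a polynomial inequality.
\<close>

lemma quartic_root_bound:
  fixes t :: real
  assumes "\<bar>t\<bar> \<le> 1 / 20"
  shows "(1 + t) powr (- 1 / 4) \<le> 1 - t / 4 + 3 * t\<^sup>2 / 16"
proof -
  define p where "p = 1 - t / 4 + 3 * t\<^sup>2 / 16"
  have p0: "p > 0" using assms unfolding p_def by (simp add: abs_le_iff add_pos_nonneg)
  have t: "1 + t > 0" using assms by linarith
  have "1 \<le> (1 + t) * p ^ 4"
  proof -
    \<comment> \<open>a quadratic slightly below \<open>p\<^sup>2 = 1 - t/2 + 7t\<^sup>2/16 - \<dots>\<close>\<close>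
    define w where "w = 1 - t / 2 + 2 * t\<^sup>2 / 5"
    have w0: "w \<ge> 0" using assms unfolding w_def by (simp add: abs_le_iff)
    have "p\<^sup>2 - w = t\<^sup>2 * (3 / 80 - 3 / 32 * t + 9 / 256 * t\<^sup>2)"
      unfolding p_def w_def by (simp add: power2_eq_square field_simps)
    also have "\<dots> \<ge> 0"
      using assms zero_le_power2[of t] by (intro mult_nonneg_nonneg) auto
    finally have "w \<le> p\<^sup>2" by simp
    then have "w\<^sup>2 \<le> (p\<^sup>2)\<^sup>2" using w0 by (intro power_mono)
    then have 1: "(1 + t) * w\<^sup>2 \<le> (1 + t) * p ^ 4" using t by (intro mult_left_mono) auto
    have "(1 + t) * w\<^sup>2 - 1 = t\<^sup>2 * (1 / 20 + 13 / 20 * t - 6 / 25 * t\<^sup>2 + 4 / 25 * t\<^sup>2 * t)"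
      unfolding w_def by (simp add: power2_eq_square field_simps)
    also have "\<dots> \<ge> 0"
    proof (rule mult_nonneg_nonneg)
      have t2: "t\<^sup>2 \<le> 1 / 400"
        using power_mono[OF assms, of 2] by (simp add: power2_eq_square)
      have "\<bar>t\<^sup>2 * t\<bar> \<le> 1 / 400 * 1"
        unfolding abs_mult using t2 assms by (intro mult_mono) auto
      then show "0 \<le> 1 / 20 + 13 / 20 * t - 6 / 25 * t\<^sup>2 + 4 / 25 * t\<^sup>2 * t"
        using assms t2 by (simp add: abs_le_iff mult.assoc)
    qed simp
    finally show ?thesis using 1 by simp
  qed
  then have "1 / (1 + t) \<le> p ^ 4" using t by (simp add: field_simps)
  moreover have "((1 + t) powr (- 1 / 4)) ^ 4 = 1 / (1 + t)"
    using t by (subst powr_power) (auto simp: powr_minus_divide)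
  ultimately show ?thesis
    unfolding p_def[symmetric] using p0 by (metis less_imp_le power_mono_iff powr_ge_zero zero_less_numeral)
qed

lemma finite_lattice_box: "finite {x :: int ^ 'd::finite. \<forall>i. \<bar>x $ i\<bar> \<le> m}"
proof (rule finite_subset)
  show "{x :: int ^ 'd. \<forall>i. \<bar>x $ i\<bar> \<le> m} \<subseteq> vec_lambda ` (PiE UNIV (\<lambda>_. {- m..m}))"
  proof
    fix x :: "int ^ 'd" assume "x \<in> {x. \<forall>i. \<bar>x $ i\<bar> \<le> m}"
    then have "vec_nth x \<in> PiE UNIV (\<lambda>_. {- m..m})" by (auto simp: abs_le_iff minus_le_iff)
    then show "x \<in> vec_lambda ` (PiE UNIV (\<lambda>_. {- m..m}))"
      by (metis image_eqI vec_nth_inverse)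
  qed
  show "finite (vec_lambda ` (PiE UNIV (\<lambda>_ :: 'd. {- m..m})))"
    by (intro finite_imageI finite_PiE) auto
qed

text \<open>
  A step changes \<open>r = |x|\<^sup>2 + K\<close> by the factor \<open>1 + t\<close> with \<open>t = (1 \<plusminus> 2 x\<^sub>i) / r\<close>. To first order in \<open>1/r\<close> the
  mean of \<open>1 - t/4 + 3t\<^sup>2/16\<close> is \<open>1 + (3/d - 1) / (4r)\<close>, at most 1 for \<open>d \<ge> 3\<close>. The constant \<open>K\<close> is large
  enough for \<open>|t| \<le> 1/20\<close> and makes the term of order \<open>r\<^bsup>-2\<^esup>\<close> strictly negative.
\<close>

lemma superharmonic_power:
  fixes x :: "int ^ 'd::finite"
  assumes d: "CARD('d) \<ge> 3" and K: "K = 900 + real CARD('d)"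
  defines "r \<equiv> sq_norm x + K"
  shows "step_avg (\<lambda>e. (sq_norm (x + e) + K) powr (- 1 / 4)) \<le> r powr (- 1 / 4) * (1 - 1 / (2 * r\<^sup>2))"
proof -
  let ?d = "real CARD('d)"
  have rK: "r \<ge> K" "r > 0" using sq_norm_nonneg[of x] K by (auto simp: r_def)
  have one: "(sq_norm (x + axis i s) + K) powr (- 1 / 4) \<le>
      r powr (- 1 / 4) * (1 - t / 4 + 3 * t\<^sup>2 / 16)"
    if "s = 1 \<or> s = -1" "t = (1 + 2 * real_of_int (x $ i) * real_of_int s) / r" for i s t
  proof -
    let ?x = "real_of_int (x $ i)"
    have "20 * (1 + 2 * \<bar>?x\<bar>) \<le> ?x\<^sup>2 + 900"
      using zero_le_power2[of "\<bar>?x\<bar> - 20"] by (simp add: power2_diff)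
    also have "\<dots> \<le> r" using component_le_sq_norm[of x i] K by (simp add: r_def)
    finally have "20 * (1 + 2 * \<bar>?x\<bar>) \<le> r" .
    moreover have "\<bar>1 + 2 * ?x * real_of_int s\<bar> \<le> 1 + 2 * \<bar>?x\<bar>" using that(1) by auto
    then have "\<bar>1 + 2 * ?x * real_of_int s\<bar> * 20 \<le> (1 + 2 * \<bar>?x\<bar>) * 20" by (rule mult_right_mono) simp
    ultimately have "\<bar>1 + 2 * ?x * real_of_int s\<bar> * 20 \<le> r" by (simp only: mult.commute)
    then have t: "\<bar>t\<bar> \<le> 1 / 20" using rK(2) by (simp add: that(2) abs_divide field_simps)
    have "sq_norm (x + axis i s) + K = r * (1 + t)"
    proof -
      have "r * t = 1 + 2 * ?x * real_of_int s"
        using rK(2) by (simp add: that(2) del: distrib_left_numeral)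
      then have "r * (1 + t) = r + (1 + 2 * ?x * real_of_int s)"
        by (simp add: distrib_left)
      then show ?thesis using that(1) by (auto simp: sq_norm_step r_def)
    qed
    then have "(sq_norm (x + axis i s) + K) powr (- 1 / 4) = r powr (- 1 / 4) * (1 + t) powr (- 1 / 4)"
      using rK(2) t by (simp add: powr_mult)
    also have "\<dots> \<le> r powr (- 1 / 4) * (1 - t / 4 + 3 * t\<^sup>2 / 16)"
      by (intro mult_left_mono quartic_root_bound t) auto
    finally show ?thesis .
  qed
  have "(\<Sum>i\<in>UNIV. (sq_norm (x + axis i 1) + K) powr (- 1 / 4) + (sq_norm (x + axis i (-1)) + K) powr (- 1 / 4))
     \<le> (\<Sum>i\<in>UNIV. r powr (- 1 / 4) * (2 - 1 / (2 * r) + 3 / (8 * r\<^sup>2) + 3 / (2 * r\<^sup>2) * (real_of_int (x $ i))\<^sup>2))"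
  proof (rule sum_mono)
    fix i :: 'd
    let ?x = "real_of_int (x $ i)"
    have plus: "(sq_norm (x + axis i 1) + K) powr (- 1 / 4) \<le>
        r powr (- 1 / 4) * (1 - ((1 + 2 * ?x) / r) / 4 + 3 * ((1 + 2 * ?x) / r)\<^sup>2 / 16)"
      by (rule one) simp_all
    have minus: "(sq_norm (x + axis i (-1)) + K) powr (- 1 / 4) \<le>
        r powr (- 1 / 4) * (1 - ((1 - 2 * ?x) / r) / 4 + 3 * ((1 - 2 * ?x) / r)\<^sup>2 / 16)"
      by (rule one) simp_all
    have "(sq_norm (x + axis i 1) + K) powr (- 1 / 4) + (sq_norm (x + axis i (-1)) + K) powr (- 1 / 4)
      \<le> r powr (- 1 / 4) * ((1 - ((1 + 2 * ?x) / r) / 4 + 3 * ((1 + 2 * ?x) / r)\<^sup>2 / 16)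
        + (1 - ((1 - 2 * ?x) / r) / 4 + 3 * ((1 - 2 * ?x) / r)\<^sup>2 / 16))"
      using add_mono[OF plus minus] by (simp only: distrib_left[symmetric])
    also have "(1 - ((1 + 2 * ?x) / r) / 4 + 3 * ((1 + 2 * ?x) / r)\<^sup>2 / 16)
        + (1 - ((1 - 2 * ?x) / r) / 4 + 3 * ((1 - 2 * ?x) / r)\<^sup>2 / 16)
      = 2 - 1 / (2 * r) + 3 / (8 * r\<^sup>2) + 3 / (2 * r\<^sup>2) * ?x\<^sup>2"
      using rK(2) by (simp add: field_simps power2_eq_square)
    finally show "(sq_norm (x + axis i 1) + K) powr (- 1 / 4) + (sq_norm (x + axis i (-1)) + K) powr (- 1 / 4)
      \<le> r powr (- 1 / 4) * (2 - 1 / (2 * r) + 3 / (8 * r\<^sup>2) + 3 / (2 * r\<^sup>2) * ?x\<^sup>2)" .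
  qed
  also have "\<dots> = r powr (- 1 / 4) * (?d * (2 - 1 / (2 * r) + 3 / (8 * r\<^sup>2)) + 3 / (2 * r\<^sup>2) * (r - K))"
  proof -
    have "r - K = (\<Sum>i\<in>UNIV. (real_of_int (x $ i))\<^sup>2)" by (simp add: r_def sq_norm_def)
    then show ?thesis by (simp only: sum_distrib_left[symmetric] sum.distrib sum_constant distrib_left)
  qed
  also have "\<dots> \<le> r powr (- 1 / 4) * ((1 - 1 / (2 * r\<^sup>2)) * (2 * ?d))"
  proof (rule mult_left_mono)
    have "3 * r \<le> ?d * r" using d rK(2) by simp
    then have "?d * (- r * 4 + 3) + 12 * (r - K) \<le> - 8 * ?d"
      using K by (simp add: algebra_simps)
    then have "(?d * (- r * 4 + 3) + 12 * (r - K)) / (8 * r\<^sup>2) \<le> - 8 * ?d / (8 * r\<^sup>2)"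
      by (intro divide_right_mono) auto
    moreover have "(?d * (- r * 4 + 3) + 12 * (r - K)) / (8 * r\<^sup>2)
      = ?d * (- 1 / (2 * r) + 3 / (8 * r\<^sup>2)) + 3 / (2 * r\<^sup>2) * (r - K)"
      using rK(2) by (simp add: field_simps power2_eq_square)
    moreover have "- 8 * ?d / (8 * r\<^sup>2) = - ?d / r\<^sup>2" by simp
    ultimately show "?d * (2 - 1 / (2 * r) + 3 / (8 * r\<^sup>2)) + 3 / (2 * r\<^sup>2) * (r - K) \<le> (1 - 1 / (2 * r\<^sup>2)) * (2 * ?d)"
      by (simp add: algebra_simps)
  qed simp
  finally show ?thesis
    unfolding step_avg_def sum_unit_steps by (simp add: pos_divide_le_eq mult.assoc)
qed

text \<open>
  By iteration such a function dominates the Green function \<open>\<Sum>\<^sub>n P(S\<^sub>n = x)\<close>, of which only upper bounds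
  are needed.
\<close>

definition green_majorant :: "(int ^ 'd::finite \<Rightarrow> real) \<Rightarrow> bool" where
  "green_majorant g \<longleftrightarrow> (\<forall>x. 0 < g x) \<and>
     (\<forall>x. step_avg (\<lambda>e. g (x + e)) + (if x = 0 then 1 else 0) \<le> g x)"

lemma green_majorant_exists:
  assumes d: "CARD('d::finite) \<ge> 3"
  obtains g :: "int ^ 'd \<Rightarrow> real"
  where "green_majorant g"
    and "\<And>\<eta>. 0 < \<eta> \<Longrightarrow> finite {x. \<eta> \<le> g x}"
proof -
  define K where "K = 900 + real CARD('d)"
  have K0: "K > 0" by (simp add: K_def)
  define f where "f = (\<lambda>x :: int ^ 'd. (sq_norm x + K) powr (- 1 / 4))"
  define h where "h = K powr (- 1 / 4) / (2 * K\<^sup>2)"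
  have h0: "h > 0" using K0 by (simp add: h_def)
  have f0: "f x > 0" for x using sq_norm_nonneg[of x] K0 by (simp add: f_def)
  have s0: "sq_norm (0 :: int ^ 'd) = 0" by (simp add: sq_norm_def)
  have step: "step_avg (\<lambda>e. f (x + e)) + (if x = 0 then h else 0) \<le> f x" for x
  proof -
    have *: "step_avg (\<lambda>e. f (x + e)) \<le> f x * (1 - 1 / (2 * (sq_norm x + K)\<^sup>2))"
      unfolding f_def by (rule superharmonic_power[OF d K_def])
    show ?thesis
    proof (cases "x = 0")
      case True
      with * show ?thesis by (simp add: f_def h_def s0 right_diff_distrib)
    next
      case False
      have "f x * (1 - 1 / (2 * (sq_norm x + K)\<^sup>2)) \<le> f x * 1"
        using f0[of x] by (intro mult_left_mono) auto
      with * False show ?thesis by simp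
    qed
  qed
  show ?thesis
  proof (rule that[of "\<lambda>x. f x / h"])
    show "green_majorant (\<lambda>x. f x / h)"
      unfolding green_majorant_def
    proof (intro conjI allI)
      fix x
      show "0 < f x / h" using f0 h0 by simp
      have "step_avg (\<lambda>e. f (x + e) / h) = step_avg (\<lambda>e. f (x + e)) / h"
        by (simp add: step_avg_def sum_divide_distrib[symmetric])
      then show "step_avg (\<lambda>e. f (x + e) / h) + (if x = 0 then 1 else 0) \<le> f x / h"
        using step[of x] h0 by (auto simp: field_simps split: if_splits)
    qed
    show "finite {x. \<eta> \<le> f x / h}" if "0 < \<eta>" for \<eta>
    proof (rule finite_subset[OF _ finite_lattice_box])
      show "{x. \<eta> \<le> f x / h} \<subseteq> {x. \<forall>i. \<bar>x $ i\<bar> \<le> \<lceil>(\<eta> * h) powr (-4)\<rceil>}"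
      proof safe
        fix x :: "int ^ 'd" and i
        assume "\<eta> \<le> f x / h"
        then have 1: "\<eta> * h \<le> f x" using h0 by (simp add: field_simps)
        have p: "\<eta> * h > 0" using that h0 by simp
        have r: "sq_norm x + K > 0" using sq_norm_nonneg[of x] K0 by linarith
        have "sq_norm x + K = f x powr (-4)" using r by (simp add: f_def powr_powr)
        also have "\<dots> \<le> (\<eta> * h) powr (-4)"
          using powr_mono2'[OF _ p 1, of "-4"] by simp
        finally have "sq_norm x \<le> (\<eta> * h) powr (-4)" using K0 by simp
        moreover have "real_of_int \<bar>x $ i\<bar> \<le> (real_of_int (x $ i))\<^sup>2"
        proof -
          have "\<bar>x $ i\<bar> \<le> (x $ i)\<^sup>2"
            using self_le_power[of "\<bar>x $ i\<bar>" 2] by (cases "x $ i = 0") auto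
          then show ?thesis by (metis of_int_le_iff of_int_power)
        qed
        ultimately have "real_of_int \<bar>x $ i\<bar> \<le> (\<eta> * h) powr (-4)"
          using component_le_sq_norm[of x i] by linarith
        then show "\<bar>x $ i\<bar> \<le> \<lceil>(\<eta> * h) powr (-4)\<rceil>" by (simp add: le_ceiling_iff)
      qed
    qed
  qed
qed

section \<open>Expectations over walks absorbed at a point\<close>

text \<open>
  \<open>walkE y n x F\<close> is the expectation of \<open>F b z\<close> for the walk from \<open>x\<close>, stopped at time \<open>n\<close> or at its first
  visit to \<open>y\<close>. Here \<open>z\<close> is the final position, and \<open>b\<close> lists the earlier ones in order of time; the
  final one is left to the next block, which starts there.
\<close>

primrec walkE :: "int ^ 'd::finite \<Rightarrow> nat \<Rightarrow> int ^ 'd \<Rightarrow> ((int ^ 'd) list \<Rightarrow> int ^ 'd \<Rightarrow> real) \<Rightarrow> real" where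
  "walkE y 0 x F = F [] x"
| "walkE y (Suc n) x F =
     (if x = y then F [] x else step_avg (\<lambda>e. walkE y n (x + e) (\<lambda>b z. F (x # b) z)))"

lemma walkE_const [simp]: "walkE y n x (\<lambda>b z. c) = c"
  by (induction n arbitrary: x) auto

lemma walkE_add: "walkE y n x (\<lambda>b z. F b z + G b z) = walkE y n x F + walkE y n x G"
  by (induction n arbitrary: x F G) (auto simp: step_avg_add)

lemma walkE_diff: "walkE y n x (\<lambda>b z. F b z - G b z) = walkE y n x F - walkE y n x G"
  by (induction n arbitrary: x F G) (auto simp: step_avg_diff)

lemma walkE_cmult: "walkE y n x (\<lambda>b z. c * F b z) = c * walkE y n x F"
  by (induction n arbitrary: x F) (auto simp: step_avg_cmult)

lemma walkE_sum: "walkE y n x (\<lambda>b z. \<Sum>a\<in>A. F a b z) = (\<Sum>a\<in>A. walkE y n x (F a))"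
  by (induction A rule: infinite_finite_induct) (auto simp: walkE_add)

lemma walkE_mono:
  assumes "\<And>b z. length b \<le> n \<Longrightarrow> F b z \<le> G b z"
  shows "walkE y n x F \<le> walkE y n x G"
  using assms
proof (induction n arbitrary: x F G)
  case (Suc n)
  then show ?case by (auto intro!: step_avg_mono Suc.IH)
qed auto

lemma walkE_integral:
  assumes "\<And>b z. integrable N (\<lambda>w. F w b z)"
  shows "integrable N (\<lambda>w. walkE y n x (F w)) \<and>
    (\<integral>w. walkE y n x (F w) \<partial>N) = walkE y n x (\<lambda>b z. \<integral>w. F w b z \<partial>N)"
  using assms
proof (induction n arbitrary: x F)
  case (Suc n)
  have IH: "integrable N (\<lambda>w. walkE y n (x + e) (\<lambda>b z. F w (x # b) z))"
    "(\<integral>w. walkE y n (x + e) (\<lambda>b z. F w (x # b) z) \<partial>N) = walkE y n (x + e) (\<lambda>b z. \<integral>w. F w (x # b) z \<partial>N)" for e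
    using Suc.IH[of "\<lambda>w b z. F w (x # b) z" "x + e"] Suc.prems by auto
  show ?case
    using Suc.prems IH by (auto simp: step_avg_def Bochner_Integration.integral_sum)
qed auto

text \<open>
  Absorption shortens the walk little, as the probability of reaching \<open>y\<close> from \<open>x\<close> is at most \<open>F x\<close>.
\<close>

lemma walkE_length_lower:
  assumes "\<And>x. step_avg (\<lambda>e. F (x + e)) \<le> F x" "1 \<le> F y" and Fpos: "\<And>x. 0 \<le> F x"
  shows "real n * (1 - F x) \<le> walkE y n x (\<lambda>b _. real (length b))"
proof (induction n arbitrary: x)
  case (Suc n)
  show ?case
  proof (cases "x = y")
    case True
    then show ?thesis using assms(2) by (auto intro: mult_nonneg_nonpos)
  next
    case False
    have "real (Suc n) * (1 - F x) \<le> 1 + real n * (1 - step_avg (\<lambda>e. F (x + e)))"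
      using assms(1)[of x] Fpos[of x] mult_left_mono[OF assms(1)[of x], of "real n"]
      by (simp add: algebra_simps)
    also have "real n * (1 - step_avg (\<lambda>e. F (x + e))) = step_avg (\<lambda>e. real n * (1 - F (x + e)))"
      by (simp only: step_avg_cmult step_avg_diff step_avg_const)
    also have "\<dots> \<le> step_avg (\<lambda>e. walkE y n (x + e) (\<lambda>b _. real (length b)))"
      by (rule step_avg_mono) (rule Suc.IH)
    finally show ?thesis using False by (simp add: walkE_add step_avg_add)
  qed
qed auto

lemma walkE_visits_upper:
  assumes "\<And>x. 0 \<le> g x" "\<And>x. step_avg (\<lambda>e. g (x + e)) + (if x = 0 then 1 else 0) \<le> g x"
  shows "walkE y n x (\<lambda>b _. real (count_list b a)) \<le> g (x - a)"
proof (induction n arbitrary: x)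
  case (Suc n)
  have "step_avg (\<lambda>e. walkE y n (x + e) (\<lambda>b _. real (count_list (x # b) a)))
    = step_avg (\<lambda>e. (if x = a then 1 else 0) + walkE y n (x + e) (\<lambda>b _. real (count_list b a)))"
    by (auto intro!: step_avg_cong simp: walkE_add)
  also have "\<dots> = (if x = a then 1 else 0) + step_avg (\<lambda>e. walkE y n (x + e) (\<lambda>b _. real (count_list b a)))"
    by (simp add: step_avg_add)
  also have "step_avg (\<lambda>e. walkE y n (x + e) (\<lambda>b _. real (count_list b a))) \<le> step_avg (\<lambda>e. g ((x - a) + e))"
    by (rule step_avg_mono) (metis Suc.IH add_diff_eq add.commute)
  also have "(if x = a then 1 else 0) + step_avg (\<lambda>e. g ((x - a) + e)) \<le> g (x - a)"
    using assms(2)[of "x - a"] by (simp split: if_splits)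
  finally show ?case using assms(1) by simp
qed (use assms in auto)

section \<open>Returns and the expected number of killed sites\<close>

text \<open>
  The probability of visiting 0 during the times \<open>0, \<dots>, n - 1\<close>.
\<close>

primrec hit_prob :: "nat \<Rightarrow> int ^ 'd::finite \<Rightarrow> real" where
  "hit_prob 0 z = 0"
| "hit_prob (Suc n) z = (if z = 0 then 1 else step_avg (\<lambda>e. hit_prob n (z + e)))"

lemma hit_prob_le_superharmonic:
  assumes "\<And>z. 0 \<le> F z" "\<And>z. step_avg (\<lambda>e. F (z + e)) \<le> F z" "1 \<le> F 0"
  shows "hit_prob n z \<le> F z"
proof (induction n arbitrary: z)
  case (Suc n)
  have "step_avg (\<lambda>e. hit_prob n (z + e)) \<le> step_avg (\<lambda>e. F (z + e))"
    by (intro step_avg_mono Suc)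
  also have "\<dots> \<le> F z" by (rule assms)
  finally show ?case using assms by auto
qed (use assms in auto)

text \<open>
  \<open>E (1 - s\<^sup>L)\<close> times the escape probability \<open>q\<close>, for a geometric local time \<open>L\<close> of parameter \<open>q\<close>: the mean
  loss at a newly visited site, times the asymptotic probability that a step reaches a new site.
\<close>

definition kill_fun :: "real \<Rightarrow> real \<Rightarrow> real" where
  "kill_fun q s = q * (1 - s) / (1 - (1 - q) * s)"

text \<open>
  For a geometric number \<open>R\<close> of returns, \<open>E s\<^sup>R = q / (1 - (1 - q) s)\<close> is the fixed point of the first-return
  decomposition \<open>e = q + (1 - q) s e\<close>. Over a finite horizon, or with absorption, returns are only rarer,
  so the fixed point is a lower bound; the statement for a general starting point \<open>z\<close> carries the induction.
\<close>

lemma walkE_return: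
  assumes s: "0 \<le> s" "s \<le> 1" and q: "0 < q" "q \<le> 1"
    and hit: "\<And>n. step_avg (\<lambda>e. hit_prob n (e :: int ^ 'd::finite)) \<le> 1 - q"
  defines "es \<equiv> q / (1 - (1 - q) * s)"
  shows "1 - hit_prob n (z - x) * (1 - s * es) \<le> walkE y n (z :: int ^ 'd) (\<lambda>b _. s ^ count_list b x)"
proof -
  have den: "q \<le> 1 - (1 - q) * s"
    using mult_left_mono[of s 1 "1 - q"] s q by simp
  have es: "0 \<le> es" "es \<le> 1" "es * (1 - (1 - q) * s) = q"
    using den q by (auto simp: es_def)
  have ses: "s * es \<le> 1" using s es by (simp add: mult_le_one)
  have nonneg: "0 \<le> hit_prob n v" for n and v :: "int ^ 'd"
    by (induction n arbitrary: v) (auto intro: step_avg_nonneg)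
  show ?thesis
  proof (induction n arbitrary: z)
    case (Suc n)
    have rec: "1 - step_avg (\<lambda>e. hit_prob n (z - x + e)) * (1 - s * es)
        \<le> step_avg (\<lambda>e. walkE y n (z + e) (\<lambda>b _. s ^ count_list b x))"
    proof -
      have "1 - step_avg (\<lambda>e. hit_prob n (z - x + e)) * (1 - s * es)
         = step_avg (\<lambda>e. 1 - (1 - s * es) * hit_prob n ((z + e) - x))"
        by (simp only: step_avg_diff step_avg_cmult step_avg_const diff_add_eq mult.commute)
      also have "\<dots> \<le> step_avg (\<lambda>e. walkE y n (z + e) (\<lambda>b _. s ^ count_list b x))"
        using Suc.IH by (intro step_avg_mono) (simp add: mult.commute)
      finally show ?thesis .
    qed
    consider "z = y" | "z \<noteq> y" "z = x" | "z \<noteq> y" "z \<noteq> x" by blast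
    then show ?case
    proof cases
      case 1
      have "0 \<le> hit_prob (Suc n) (z - x) * (1 - s * es)"
        using ses by (intro mult_nonneg_nonneg nonneg) simp
      then show ?thesis using 1 by simp
    next
      case 2
      have "es = q + (1 - q) * (s * es)" using es(3) by (simp add: algebra_simps)
      also have "\<dots> = 1 - (1 - q) * (1 - s * es)" by (simp add: algebra_simps)
      also have "\<dots> \<le> 1 - step_avg (\<lambda>e. hit_prob n (z - x + e)) * (1 - s * es)"
        using hit[of n] ses 2 by (simp add: mult_right_mono)
      also note rec
      finally have "s * es \<le> s * step_avg (\<lambda>e. walkE y n (z + e) (\<lambda>b _. s ^ count_list b x))"
        using s by (intro mult_left_mono)
      then show ?thesis using 2 by (simp add: walkE_cmult step_avg_cmult)
    next
      case 3
      then show ?thesis using rec by simp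
    qed
  qed simp
qed

text \<open>
  The telescoping \<open>1 - s\<^sup>L = \<Sum>\<^bsub>j<L\<^esub> (1 - s) s\<^sup>j\<close>, distributed over the \<open>L\<close> visits so that each visit pays
  according to the number of later ones. With later instead of earlier visits, the Markov property applies
  without time reversal.
\<close>

lemma sum_killed_Cons:
  fixes s :: real
  shows "(\<Sum>v\<in>set (x # b). 1 - s ^ count_list (x # b) v)
    = (1 - s) * s ^ count_list b x + (\<Sum>v\<in>set b. 1 - s ^ count_list b v)"
proof -
  let ?f = "\<lambda>v. 1 - s ^ count_list b v" and ?g = "\<lambda>v. 1 - s ^ count_list (x # b) v"
  have "(\<Sum>v\<in>set (x # b). ?g v) = ?g x + (\<Sum>v\<in>set (x # b) - {x}. ?g v)"
    by (rule sum.remove) auto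
  also have "(\<Sum>v\<in>set (x # b) - {x}. ?g v) = (\<Sum>v\<in>set b - {x}. ?f v)"
    by (rule sum.cong) auto
  also have "\<dots> = (\<Sum>v\<in>set b. ?f v) - ?f x"
    by (cases "x \<in> set b") (auto simp: sum_diff1 count_notin)
  finally show ?thesis by (simp add: algebra_simps)
qed

lemma walkE_killed_lower:
  assumes s: "0 \<le> s" "s \<le> 1" and q: "0 < q" "q \<le> 1"
    and hit: "\<And>n. step_avg (\<lambda>e. hit_prob n (e :: int ^ 'd::finite)) \<le> 1 - q"
  shows "kill_fun q s * walkE y n (x :: int ^ 'd) (\<lambda>b _. real (length b))
     \<le> walkE y n x (\<lambda>b _. \<Sum>v\<in>set b. 1 - s ^ count_list b v)"
proof (induction n arbitrary: x)
  case (Suc n)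
  define es where "es = q / (1 - (1 - q) * s)"
  have den: "q \<le> 1 - (1 - q) * s"
    using mult_left_mono[of s 1 "1 - q"] s q by simp
  have es3: "es * (1 - (1 - q) * s) = q" using den q by (auto simp: es_def)
  have "0 \<le> es" "es \<le> 1" using den q by (auto simp: es_def)
  then have ses: "s * es \<le> 1" using s by (simp add: mult_le_one)
  have k: "kill_fun q s = (1 - s) * es" by (simp add: kill_fun_def es_def)
  show ?case
  proof (cases "x = y")
    case False
    have "es = 1 - (1 - q) * (1 - s * es)" using es3 by (simp add: algebra_simps)
    also have "\<dots> \<le> 1 - step_avg (\<lambda>e. hit_prob n (e :: int ^ 'd)) * (1 - s * es)"
      using hit[of n] ses by (simp add: mult_right_mono)
    also have "\<dots> = step_avg (\<lambda>e. 1 - (1 - s * es) * hit_prob n ((x + e) - x))"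
      unfolding mult.commute[of _ "1 - s * es"]
      by (simp only: step_avg_diff step_avg_cmult step_avg_const add_diff_cancel_left')
    also have "\<dots> \<le> step_avg (\<lambda>e. walkE y n (x + e) (\<lambda>b _. s ^ count_list b x))"
      using walkE_return[OF s q hit, of n _ x y, folded es_def]
      by (intro step_avg_mono) (metis mult.commute)
    finally have 1: "(1 - s) * es \<le> (1 - s) * step_avg (\<lambda>e. walkE y n (x + e) (\<lambda>b _. s ^ count_list b x))"
      using s by (intro mult_left_mono) auto
    have "kill_fun q s * walkE y (Suc n) x (\<lambda>b _. real (length b))
      = (1 - s) * es + step_avg (\<lambda>e. kill_fun q s * walkE y n (x + e) (\<lambda>b _. real (length b)))"
      using False by (simp add: walkE_add step_avg_add k distrib_left step_avg_cmult)
    also have "\<dots> \<le> (1 - s) * step_avg (\<lambda>e. walkE y n (x + e) (\<lambda>b _. s ^ count_list b x))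
       + step_avg (\<lambda>e. walkE y n (x + e) (\<lambda>b _. \<Sum>v\<in>set b. 1 - s ^ count_list b v))"
      by (intro add_mono 1 step_avg_mono Suc.IH)
    also have "\<dots> = walkE y (Suc n) x (\<lambda>b _. \<Sum>v\<in>set b. 1 - s ^ count_list b v)"
      using False by (simp only: walkE.simps if_False sum_killed_Cons walkE_add walkE_cmult step_avg_add step_avg_cmult)
    finally show ?thesis .
  qed simp
qed simp

lemma power_complement_le: "0 \<le> s \<Longrightarrow> s \<le> 1 \<Longrightarrow> 1 - (s::real) ^ k \<le> real k * (1 - s)"
  using Bernoulli_inequality[of "s - 1" k] by (simp add: algebra_simps)

lemma sum_killed_restrict:
  fixes s :: real
  assumes s: "0 \<le> s" "s \<le> 1"
  shows "(\<Sum>v\<in>set b. 1 - s ^ count_list b v) - (1 - s) * real (length (filter (\<lambda>v. v \<notin> D) b))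
     \<le> (\<Sum>v\<in>set b \<inter> D. 1 - s ^ count_list b v)"
proof -
  have "(\<Sum>v\<in>set b. 1 - s ^ count_list b v)
      = (\<Sum>v\<in>set b \<inter> D. 1 - s ^ count_list b v) + (\<Sum>v\<in>set b - D. 1 - s ^ count_list b v)"
    by (rule sum.Int_Diff) simp
  also have "(\<Sum>v\<in>set b - D. 1 - s ^ count_list b v) \<le> (\<Sum>v\<in>set b - D. real (count_list b v) * (1 - s))"
    by (intro sum_mono power_complement_le s)
  also have "\<dots> = (1 - s) * real (\<Sum>v\<in>set b - D. count_list b v)"
    by (simp add: sum_distrib_left mult.commute)
  also have "(\<Sum>v\<in>set b - D. count_list b v) = (\<Sum>v\<in>set (filter (\<lambda>v. v \<notin> D) b). count_list (filter (\<lambda>v. v \<notin> D) b) v)"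
  proof (rule sum.cong)
    fix v assume "v \<in> set (filter (\<lambda>v. v \<notin> D) b)"
    then have "v \<notin> D" by auto
    then show "count_list b v = count_list (filter (\<lambda>v. v \<notin> D) b) v"
      by (induction b) auto
  qed auto
  also have "\<dots> = length (filter (\<lambda>v. v \<notin> D) b)" by (rule sum_count_set) auto
  finally show ?thesis by simp
qed

section \<open>Annealed weights and the estimate for one block\<close>

definition weight :: "(nat \<Rightarrow> real) \<Rightarrow> 'a set \<Rightarrow> 'a list \<Rightarrow> real" where
  "weight \<phi> D b = (\<Prod>v\<in>set b \<inter> D. \<phi> (count_list b v))"

lemma prod_complement_lower:
  fixes a :: "'a \<Rightarrow> real"
  assumes "finite A" "\<And>v. v \<in> A \<Longrightarrow> 0 \<le> a v \<and> a v \<le> 1"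
  shows "1 - sum a A \<le> (\<Prod>v\<in>A. 1 - a v)"
  using assms
proof (induction A rule: finite_induct)
  case (insert v A)
  have "0 \<le> (\<Prod>v\<in>A. 1 - a v)" "(\<Prod>v\<in>A. 1 - a v) \<le> 1"
    using insert by (auto intro!: prod_nonneg prod_le_1)
  then have "a v * (\<Prod>v\<in>A. 1 - a v) \<le> a v" using insert.prems by (simp add: mult_left_le)
  then show ?case using insert by (simp add: left_diff_distrib)
qed simp

text \<open>
  The second Bonferroni-type bound. It turns a lower bound for the mean of \<open>\<Sum> a\<close> into an upper bound for the
  mean of the product, at the price of a quadratic error.
\<close>

lemma prod_complement_upper:
  fixes a :: "'a \<Rightarrow> real"
  assumes "finite A" "\<And>v. v \<in> A \<Longrightarrow> 0 \<le> a v \<and> a v \<le> 1"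
  shows "(\<Prod>v\<in>A. 1 - a v) \<le> 1 - sum a A + (sum a A)\<^sup>2 / 2"
  using assms
proof (induction A rule: finite_induct)
  case (insert v A)
  let ?S = "sum a A"
  have S: "0 \<le> ?S" "0 \<le> a v" "a v \<le> 1" using insert.prems by (auto intro: sum_nonneg)
  have "(\<Prod>v\<in>insert v A. 1 - a v) \<le> (1 - a v) * (1 - ?S + ?S\<^sup>2 / 2)"
    using insert S by (simp add: mult_left_mono)
  also have "\<dots> = 1 - (a v + ?S) + (a v + ?S)\<^sup>2 / 2 - a v * ?S\<^sup>2 / 2 - (a v)\<^sup>2 / 2"
    by (simp add: power2_eq_square field_simps)
  also have "\<dots> \<le> 1 - (a v + ?S) + (a v + ?S)\<^sup>2 / 2"
    using mult_nonneg_nonneg[OF S(2) zero_le_power2[of ?S]] zero_le_power2[of "a v"] by linarith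
  finally show ?case using insert by simp
qed simp

lemma walkE_level_sq:
  fixes x y :: "int ^ 'd::finite"
  assumes "norm l = 1"
  shows "walkE y n x (\<lambda>_ z. (level l z - c)\<^sup>2) \<le> (level l x - c)\<^sup>2 + real n"
proof (induction n arbitrary: x)
  case (Suc n)
  have "step_avg (\<lambda>e. walkE y n (x + e) (\<lambda>_ z. (level l z - c)\<^sup>2))
     \<le> step_avg (\<lambda>e. (level l (x + e) - c)\<^sup>2 + real n)"
    by (intro step_avg_mono Suc)
  also have "\<dots> = step_avg (\<lambda>e. ((level l x - c)\<^sup>2 + real n) + level l e * (2 * (level l x - c)) + (level l e)\<^sup>2)"
    by (intro step_avg_cong) (simp add: level_add power2_eq_square algebra_simps)
  also have "\<dots> = (level l x - c)\<^sup>2 + real n + 1 / real CARD('d)"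
    by (simp only: step_avg_add step_avg_const step_avg_level_linear step_avg_level_square[OF assms])
  also have "\<dots> \<le> (level l x - c)\<^sup>2 + real (Suc n)"
    using zero_less_card_finite[where 'a = 'd] by simp
  finally show ?case by auto
qed simp

lemma walkE_sum_level_sq:
  fixes x y :: "int ^ 'd::finite"
  assumes "norm l = 1"
  shows "walkE y n x (\<lambda>b _. \<Sum>v\<leftarrow>b. (level l v - c)\<^sup>2) \<le> real n * ((level l x - c)\<^sup>2 + real n)"
proof (induction n arbitrary: x)
  case (Suc n)
  have card: "1 / real CARD('d) \<le> 1" using zero_less_card_finite[where 'a = 'd] by simp
  have "step_avg (\<lambda>e. walkE y n (x + e) (\<lambda>b z. \<Sum>v\<leftarrow>x # b. (level l v - c)\<^sup>2))
     \<le> step_avg (\<lambda>e. (level l x - c)\<^sup>2 + real n * ((level l (x + e) - c)\<^sup>2 + real n))"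
    using Suc by (intro step_avg_mono) (simp add: walkE_add)
  also have "\<dots> = step_avg (\<lambda>e. ((level l x - c)\<^sup>2 + real n * ((level l x - c)\<^sup>2 + real n))
      + level l e * (2 * real n * (level l x - c)) + real n * (level l e)\<^sup>2)"
    by (intro step_avg_cong) (simp add: level_add power2_eq_square algebra_simps)
  also have "\<dots> = (level l x - c)\<^sup>2 + real n * ((level l x - c)\<^sup>2 + real n) + real n * (1 / real CARD('d))"
    by (simp only: step_avg_add step_avg_cmult step_avg_const step_avg_level_linear step_avg_level_square[OF assms])
  also have "\<dots> \<le> (level l x - c)\<^sup>2 + real n * ((level l x - c)\<^sup>2 + real n) + real n * 1"
    using card by (intro add_left_mono mult_left_mono) auto
  also have "\<dots> \<le> real (Suc n) * ((level l x - c)\<^sup>2 + real (Suc n))"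
    by (simp add: algebra_simps)
  finally show ?case by auto
qed simp

text \<open>
  Time spent outside the set \<open>D\<close> of chargeable sites is either spent on the finite set \<open>A\<close> of sites charged
  before, or spent at distance \<open>s0\<close> from the starting level, which Chebyshev's inequality bounds.
\<close>

lemma length_filter_bound:
  fixes b :: "(int ^ 'd::finite) list"
  assumes "finite A" "s0 > 0" "\<And>v. v \<notin> D \<Longrightarrow> v \<in> A \<or> s0 \<le> \<bar>level l v - c\<bar>"
  shows "real (length (filter (\<lambda>v. v \<notin> D) b))
    \<le> (\<Sum>a\<in>A. real (count_list b a)) + (1 / s0\<^sup>2) * (\<Sum>v\<leftarrow>b. (level l v - c)\<^sup>2)"
proof (induction b)
  case (Cons v b)
  have 1: "(if v \<notin> D then 1 else 0) \<le> (if v \<in> A then 1 else 0) + (1 / s0\<^sup>2) * (level l v - c)\<^sup>2"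
  proof (cases "v \<in> D \<or> v \<in> A")
    case False
    then have "s0\<^sup>2 \<le> (level l v - c)\<^sup>2" using assms(2) assms(3)[of v] by (simp add: abs_le_square_iff[symmetric])
    then show ?thesis using False assms(2) by simp
  qed auto
  have "(\<Sum>a\<in>A. real (count_list (v # b) a)) = (\<Sum>a\<in>A. real (count_list b a) + (if v = a then 1 else 0))"
    by (intro sum.cong) auto
  also have "\<dots> = (\<Sum>a\<in>A. real (count_list b a)) + (if v \<in> A then 1 else 0)"
    using assms(1) by (simp add: sum.distrib)
  finally have 2: "(\<Sum>a\<in>A. real (count_list (v # b) a)) = (\<Sum>a\<in>A. real (count_list b a)) + (if v \<in> A then 1 else 0)" .
  have "real (length (filter (\<lambda>v. v \<notin> D) (v # b))) = (if v \<notin> D then 1 else 0) + real (length (filter (\<lambda>v. v \<notin> D) b))"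
    by simp
  also have "\<dots> \<le> ((if v \<in> A then 1 else 0) + (1 / s0\<^sup>2) * (level l v - c)\<^sup>2)
      + ((\<Sum>a\<in>A. real (count_list b a)) + (1 / s0\<^sup>2) * (\<Sum>v\<leftarrow>b. (level l v - c)\<^sup>2))"
    by (intro add_mono 1 Cons)
  finally show ?case unfolding 2 by (simp add: distrib_left)
qed simp

text \<open>
  The law \<open>N\<close> of the potential enters only through the random survival factor \<open>s\<close>, and the random walk
  only through \<open>q\<close> and \<open>g\<close>. Since \<open>q\<close> and \<open>g\<close> do not depend on \<open>\<beta>\<close>, constants built from them are uniform.
\<close>

locale annealed = prob_space N for N :: "'p measure" +
  fixes s :: "'p \<Rightarrow> real" and q :: real and g :: "int ^ 'd::finite \<Rightarrow> real"
  assumes s_measurable [measurable]: "s \<in> borel_measurable N"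
    and s_range: "\<And>w. 0 \<le> s w" "\<And>w. s w \<le> 1"
    and q: "0 < q" "q \<le> 1"
    and hit: "\<And>n. step_avg (\<lambda>e. hit_prob n (e :: int ^ 'd)) \<le> 1 - q"
    and majorant: "green_majorant g"
begin

definition phi :: "nat \<Rightarrow> real" where "phi k = (\<integral>w. s w ^ k \<partial>N)"

definition rate :: real where "rate = (\<integral>w. kill_fun q (s w) \<partial>N)"

lemma integrable_bounded:
  assumes "f \<in> borel_measurable N" "\<And>w. \<bar>f w\<bar> \<le> (1::real)"
  shows "integrable N f"
  by (rule integrable_const_bound[where B = 1]) (use assms in auto)

lemma integrable_power: "integrable N (\<lambda>w. s w ^ k)"
  using s_range by (intro integrable_bounded) (auto simp: power_le_one)

lemma phi_0 [simp]: "phi 0 = 1"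
  by (simp add: phi_def prob_space)

lemma phi_antimono: "j \<le> k \<Longrightarrow> phi k \<le> phi j"
  unfolding phi_def using s_range by (intro integral_mono integrable_power power_decreasing) auto

lemma phi_nonneg: "0 \<le> phi k"
  unfolding phi_def using s_range by (intro Bochner_Integration.integral_nonneg) auto

lemma phi_le_1: "phi k \<le> 1"
  using phi_antimono[of 0 k] by simp

lemma kill_fun_bounds:
  assumes "0 \<le> t" "t \<le> 1"
  shows "q * (1 - t) \<le> kill_fun q t" "kill_fun q t \<le> 1" "0 \<le> kill_fun q t"
proof -
  have den: "q \<le> 1 - (1 - q) * t" "1 - (1 - q) * t \<le> 1"
    using mult_left_mono[of t 1 "1 - q"] assms q by simp_all
  have "q * (1 - t) \<ge> 0" using assms q by simp
  then show "q * (1 - t) \<le> kill_fun q t" "0 \<le> kill_fun q t"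
    using den q assms by (auto simp: kill_fun_def pos_le_divide_eq intro!: mult_left_le)
  have "0 \<le> (1 - q) * (1 - t) + q * t" using assms q by simp
  then have "q * (1 - t) \<le> 1 - (1 - q) * t" by (simp add: algebra_simps)
  then show "kill_fun q t \<le> 1" using den q by (simp add: kill_fun_def)
qed

lemma integrable_kill_fun: "integrable N (\<lambda>w. kill_fun q (s w))"
proof (rule integrable_bounded)
  show "(\<lambda>w. kill_fun q (s w)) \<in> borel_measurable N" unfolding kill_fun_def by measurable
  show "\<bar>kill_fun q (s w)\<bar> \<le> 1" for w using kill_fun_bounds[OF s_range]
    by (simp add: abs_le_iff order_trans[of _ 0])
qed

lemma rate_nonneg: "0 \<le> rate"
  unfolding rate_def using kill_fun_bounds(3)[OF s_range] by (intro Bochner_Integration.integral_nonneg)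

lemma one_minus_phi_1: "1 - phi 1 \<le> rate / q"
proof -
  have "q * (1 - phi 1) = (\<integral>w. q * (1 - s w) \<partial>N)"
    using integrable_power[of 1] by (simp add: phi_def prob_space)
  also have "\<dots> \<le> rate"
    unfolding rate_def using integrable_power[of 1] kill_fun_bounds(1)[OF s_range]
    by (intro integral_mono integrable_kill_fun) auto
  finally show ?thesis using q by (simp add: pos_le_divide_eq mult.commute)
qed

lemma one_minus_phi: "1 - phi k \<le> real k * (1 - phi 1)"
proof -
  have "(\<integral>w. 1 - s w ^ k \<partial>N) \<le> (\<integral>w. real k * (1 - s w) \<partial>N)"
    using integrable_power[of 1] integrable_power[of k] s_range
    by (intro integral_mono power_complement_le) auto
  then show ?thesis
    using integrable_power[of 1] integrable_power[of k] by (simp add: phi_def prob_space)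
qed

text \<open>
  The first-order loss of weight of the block \<open>b\<close> when only sites in \<open>D\<close> are charged.
\<close>

definition kills :: "(int ^ 'd) set \<Rightarrow> (int ^ 'd) list \<Rightarrow> real" where
  "kills D b = (\<Sum>v\<in>set b \<inter> D. 1 - phi (count_list b v))"

lemma kills_nonneg: "0 \<le> kills D b"
  unfolding kills_def using phi_le_1 by (intro sum_nonneg) auto

lemma kills_upper: "kills D b \<le> real (length b) * rate / q"
proof -
  have "kills D b \<le> (\<Sum>v\<in>set b. 1 - phi (count_list b v))"
    unfolding kills_def using phi_le_1 by (intro sum_mono2) auto
  also have "\<dots> \<le> (\<Sum>v\<in>set b. real (count_list b v) * (1 - phi 1))"
    by (intro sum_mono one_minus_phi)
  also have "\<dots> = real (\<Sum>v\<in>set b. count_list b v) * (1 - phi 1)"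
    by (simp add: sum_distrib_right)
  also have "\<dots> = real (length b) * (1 - phi 1)"
    by (subst sum_count_set) auto
  also have "\<dots> \<le> real (length b) * (rate / q)"
    by (intro mult_left_mono one_minus_phi_1) auto
  finally show ?thesis by simp
qed

lemma one_minus_weight:
  "1 - weight phi D b \<le> kills D b" "kills D b - (kills D b)\<^sup>2 / 2 \<le> 1 - weight phi D b"
  using prod_complement_lower[of "set b \<inter> D" "\<lambda>v. 1 - phi (count_list b v)"]
    prod_complement_upper[of "set b \<inter> D" "\<lambda>v. 1 - phi (count_list b v)"] phi_nonneg phi_le_1
  by (auto simp: weight_def kills_def)

lemma weight_range: "0 \<le> weight phi D b" "weight phi D b \<le> 1"
  unfolding weight_def using phi_nonneg phi_le_1 by (auto intro!: prod_nonneg prod_le_1)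

lemma g_pos: "0 < g x"
  and g_super: "step_avg (\<lambda>e. g (x + e)) + (if x = 0 then 1 else 0) \<le> g x"
  using majorant by (auto simp: green_majorant_def)

lemma g_superharmonic: "step_avg (\<lambda>e. g (x + e)) \<le> g x"
  using g_super[of x] by (simp split: if_splits)

lemma walkE_kills_lower:
  "rate * (real n * (1 - g (x - y) / g 0))
     - rate / q * walkE y n x (\<lambda>b _. real (length (filter (\<lambda>v. v \<notin> D) b)))
   \<le> walkE y n x (\<lambda>b _. kills D b)"
proof -
  let ?len = "walkE y n x (\<lambda>b _. real (length b))"
  let ?bad = "walkE y n x (\<lambda>b _. real (length (filter (\<lambda>v. v \<notin> D) b)))"
  have int: "integrable N (\<lambda>w. \<Sum>v\<in>set b \<inter> D. 1 - s w ^ count_list b v)" for b :: "(int ^ 'd) list"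
    using integrable_power by (intro Bochner_Integration.integrable_sum) auto
  have kills_int: "kills D b = (\<integral>w. (\<Sum>v\<in>set b \<inter> D. 1 - s w ^ count_list b v) \<partial>N)" for b
    unfolding kills_def phi_def using integrable_power
    by (simp add: Bochner_Integration.integral_sum prob_space)
  have len: "real n * (1 - g (x - y) / g 0) \<le> ?len"
  proof (rule walkE_length_lower)
    show "step_avg (\<lambda>e. g (z + e - y) / g 0) \<le> g (z - y) / g 0" for z
      using g_superharmonic[of "z - y"] g_pos[of 0] step_avg_cmult[of "1 / g 0" "\<lambda>e. g (z - y + e)"]
      by (simp add: diff_add_eq divide_right_mono)
    show "1 \<le> g (y - y) / g 0" using g_pos[of 0] by simp
    show "0 \<le> g (z - y) / g 0" for z using g_pos[of 0] g_pos[of "z - y"] by simp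
  qed
  have bad0: "0 \<le> ?bad"
    using walkE_mono[of n "\<lambda>_ _. 0" "\<lambda>b _. real (length (filter (\<lambda>v. v \<notin> D) b))" y x] by simp
  have point: "kill_fun q (s w) * ?len - (1 - s w) * ?bad
      \<le> walkE y n x (\<lambda>b _. \<Sum>v\<in>set b \<inter> D. 1 - s w ^ count_list b v)" for w
  proof -
    have "kill_fun q (s w) * ?len \<le> walkE y n x (\<lambda>b _. \<Sum>v\<in>set b. 1 - s w ^ count_list b v)"
      by (rule walkE_killed_lower[OF s_range q hit])
    then have "kill_fun q (s w) * ?len - (1 - s w) * ?bad \<le> walkE y n x (\<lambda>b _.
        (\<Sum>v\<in>set b. 1 - s w ^ count_list b v) - (1 - s w) * real (length (filter (\<lambda>v. v \<notin> D) b)))"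
      by (simp only: walkE_diff walkE_cmult diff_right_mono)
    also have "\<dots> \<le> walkE y n x (\<lambda>b _. \<Sum>v\<in>set b \<inter> D. 1 - s w ^ count_list b v)"
      by (intro walkE_mono sum_killed_restrict s_range)
    finally show ?thesis .
  qed
  have "rate * (real n * (1 - g (x - y) / g 0)) - rate / q * ?bad \<le> rate * ?len - (1 - phi 1) * ?bad"
    by (intro diff_mono mult_left_mono mult_right_mono len rate_nonneg one_minus_phi_1 bad0)
  also have "\<dots> = (\<integral>w. kill_fun q (s w) * ?len - (1 - s w) * ?bad \<partial>N)"
    using integrable_kill_fun integrable_power[of 1] by (simp add: rate_def phi_def prob_space)
  also have "\<dots> \<le> (\<integral>w. walkE y n x (\<lambda>b _. \<Sum>v\<in>set b \<inter> D. 1 - s w ^ count_list b v) \<partial>N)"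
    using walkE_integral[of N "\<lambda>w b _. \<Sum>v\<in>set b \<inter> D. 1 - s w ^ count_list b v"] int
      integrable_kill_fun integrable_power[of 1] point
    by (intro integral_mono) auto
  also have "\<dots> = walkE y n x (\<lambda>b _. kills D b)"
    using walkE_integral[of N "\<lambda>w b _. \<Sum>v\<in>set b \<inter> D. 1 - s w ^ count_list b v"] int
    by (simp add: kills_int)
  finally show ?thesis .
qed

lemma walkE_ramp:
  assumes l: "norm l = 1" and a: "0 \<le> a"
  shows "walkE y n x (\<lambda>_ z. ramp a (level l z - m))
    \<le> (1 + a\<^sup>2 / (2 * real CARD('d)) * cosh a) ^ n * ramp a (level l (x :: int ^ 'd) - m)"
proof (induction n arbitrary: x)
  case (Suc n)
  let ?K = "1 + a\<^sup>2 / (2 * real CARD('d)) * cosh a"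
  have K: "1 \<le> ?K" by (simp add: cosh_real_nonneg)
  have "step_avg (\<lambda>e. walkE y n (x + e) (\<lambda>_ z. ramp a (level l z - m)))
    \<le> step_avg (\<lambda>e. ?K ^ n * ramp a ((level l x - m) + level l e))"
  proof (rule step_avg_mono)
    fix e :: "int ^ 'd"
    show "walkE y n (x + e) (\<lambda>_ z. ramp a (level l z - m)) \<le> ?K ^ n * ramp a ((level l x - m) + level l e)"
      using Suc.IH[of "x + e"] by (simp add: level_add diff_add_eq)
  qed
  also have "\<dots> = ?K ^ n * step_avg (\<lambda>e. ramp a ((level l x - m) + level l e))"
    by (rule step_avg_cmult)
  also have "\<dots> \<le> ?K ^ n * (?K * ramp a (level l x - m))"
    using K by (intro mult_left_mono step_avg_ramp l a) auto
  finally have "step_avg (\<lambda>e. walkE y n (x + e) (\<lambda>_ z. ramp a (level l z - m))) \<le> ?K ^ Suc n * ramp a (level l x - m)"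
    by (simp add: mult.assoc mult.commute mult.left_commute)
  moreover have "ramp a (level l x - m) \<le> ?K ^ Suc n * ramp a (level l x - m)"
    using ramp_ge_1[of a "level l x - m"] one_le_power[OF K, of "Suc n"]
    by (simp add: mult_le_cancel_right1 del: power_Suc)
  ultimately show ?case by (auto simp del: power_Suc)
qed simp

text \<open>
  With \<open>W\<close> the weight of the block and \<open>r\<close> the growth function, \<open>E (W r(S\<^sub>n)) = E r(S\<^sub>n) - E ((1 - W) r(S\<^sub>n))\<close>.
  The first term grows at most by the one-step factor. In the second, replacing \<open>r(S\<^sub>n)\<close> by \<open>r(x)\<close> and
  \<open>1 - W\<close> by \<open>kills\<close> costs products of two small quantities only: \<open>kills\<close> is bounded by \<open>n rate / q\<close>, and the
  relative change of \<open>r\<close> by \<open>a\<close> times the displacement. The free parameter \<open>\<eta>\<close> comes from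
  \<open>2 u \<le> \<eta> + u\<^sup>2 / \<eta>\<close>, which reduces the displacement to its second moment.
\<close>

lemma block_estimate:
  fixes x y :: "int ^ 'd"
  assumes l: "norm l = 1" and a: "0 \<le> a" and \<eta>: "0 < \<eta>"
    and A: "finite A" and s0: "0 < s0"
    and D: "\<And>v. v \<notin> D \<Longrightarrow> v \<in> A \<or> s0 \<le> \<bar>level l v - level l x\<bar>"
  shows "walkE y n x (\<lambda>b z. weight phi D b * ramp a (level l z - m)) \<le>
    ((1 + a\<^sup>2 / (2 * real CARD('d)) * cosh a) ^ n
      - (rate * (real n * (1 - g (x - y) / g 0)) - rate / q * ((\<Sum>v\<in>A. g (x - v)) + (real n)\<^sup>2 / s0\<^sup>2))
      + (real n * rate / q)\<^sup>2 / 2 + (real n * rate / q) * ((\<eta> + a\<^sup>2 * real n / \<eta>) / 2))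
     * ramp a (level l x - m)"
proof -
  let ?r = "\<lambda>z. ramp a (level l z - m)"
  let ?X = "real n * rate / q"
  let ?\<Delta> = "\<lambda>z. (level l z - level l x)\<^sup>2"
  have X0: "0 \<le> ?X" using rate_nonneg q by simp
  have r1: "1 \<le> ?r z" for z by (rule ramp_ge_1)
  have point: "weight phi D b * ?r z \<le>
      ?r z - ?r x * (kills D b - ?X\<^sup>2 / 2 - ?X * ((\<eta> + a\<^sup>2 * ?\<Delta> z / \<eta>) / 2))"
    if b: "length b \<le> n" for b z
  proof -
    let ?W = "1 - weight phi D b" and ?u = "a * \<bar>level l z - level l x\<bar>"
    have kX: "kills D b \<le> ?X"
      using kills_upper[of D b] b rate_nonneg q
      by (meson divide_right_mono less_imp_le mult_right_mono of_nat_le_iff order_trans)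
    have u: "?u \<le> (\<eta> + a\<^sup>2 * ?\<Delta> z / \<eta>) / 2"
    proof -
      have "0 \<le> (\<eta> - ?u)\<^sup>2 / \<eta>" using \<eta> by simp
      also have "(\<eta> - ?u)\<^sup>2 / \<eta> = \<eta> + a\<^sup>2 * ?\<Delta> z / \<eta> - 2 * ?u"
        using \<eta> by (simp add: power2_diff power_mult_distrib field_simps power2_eq_square[of \<eta>])
      finally show ?thesis by simp
    qed
    have W: "0 \<le> ?W" using weight_range by simp
    have "?W * ?u \<le> ?X * ((\<eta> + a\<^sup>2 * ?\<Delta> z / \<eta>) / 2)"
      using one_minus_weight(1)[of D b] kX u X0 a by (intro mult_mono) auto
    moreover have "(kills D b)\<^sup>2 \<le> ?X\<^sup>2" using kX kills_nonneg by (intro power_mono)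
    ultimately have "kills D b - ?X\<^sup>2 / 2 - ?X * ((\<eta> + a\<^sup>2 * ?\<Delta> z / \<eta>) / 2) \<le> ?W * (1 - ?u)"
      using one_minus_weight(2)[of D b] by (simp add: right_diff_distrib)
    then have "?r x * (kills D b - ?X\<^sup>2 / 2 - ?X * ((\<eta> + a\<^sup>2 * ?\<Delta> z / \<eta>) / 2)) \<le> ?r x * (?W * (1 - ?u))"
      using r1[of x] by (intro mult_left_mono) auto
    also have "\<dots> = ?W * (?r x * (1 - ?u))" by simp
    also have "\<dots> \<le> ?W * ?r z"
      using ramp_lower[OF a, of "level l x - m" "level l z - m"] W by (intro mult_left_mono) auto
    finally show ?thesis by (simp add: left_diff_distrib)
  qed
  let ?bad = "walkE y n x (\<lambda>b _. real (length (filter (\<lambda>v. v \<notin> D) b)))"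
  have bad: "?bad \<le> (\<Sum>v\<in>A. g (x - v)) + (real n)\<^sup>2 / s0\<^sup>2"
  proof -
    have "?bad \<le> walkE y n x (\<lambda>b _. (\<Sum>v\<in>A. real (count_list b v)) + (1 / s0\<^sup>2) * (\<Sum>v\<leftarrow>b. (level l v - level l x)\<^sup>2))"
      by (intro walkE_mono length_filter_bound A s0 D)
    also have "\<dots> = (\<Sum>v\<in>A. walkE y n x (\<lambda>b _. real (count_list b v)))
        + (1 / s0\<^sup>2) * walkE y n x (\<lambda>b _. \<Sum>v\<leftarrow>b. (level l v - level l x)\<^sup>2)"
      by (simp only: walkE_add walkE_cmult walkE_sum)
    also have "\<dots> \<le> (\<Sum>v\<in>A. g (x - v)) + (1 / s0\<^sup>2) * (real n * ((level l x - level l x)\<^sup>2 + real n))"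
      using g_pos g_super
      by (intro add_mono sum_mono mult_left_mono walkE_visits_upper walkE_sum_level_sq l) (auto intro: less_imp_le)
    finally show ?thesis by (simp add: power2_eq_square)
  qed
  have "walkE y n x (\<lambda>b z. weight phi D b * ?r z) \<le> walkE y n x (\<lambda>b z.
      ?r z - ?r x * (kills D b - ?X\<^sup>2 / 2 - ?X * ((\<eta> + a\<^sup>2 * ?\<Delta> z / \<eta>) / 2)))"
    by (intro walkE_mono point)
  also have "\<dots> = walkE y n x (\<lambda>b z. ?r z - ?r x * (kills D b - ?X\<^sup>2 / 2 - (?X * \<eta> / 2 + (?X * a\<^sup>2 / \<eta> / 2) * ?\<Delta> z)))"
    by (rule arg_cong[where f = "walkE y n x"]) (simp add: fun_eq_iff algebra_simps add_divide_distrib)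
  also have "\<dots> = walkE y n x (\<lambda>_ z. ?r z) - ?r x * (walkE y n x (\<lambda>b _. kills D b) - ?X\<^sup>2 / 2
      - (?X * \<eta> / 2 + (?X * a\<^sup>2 / \<eta> / 2) * walkE y n x (\<lambda>_ z. ?\<Delta> z)))"
    by (simp only: walkE_diff walkE_cmult walkE_add walkE_const)
  also have "\<dots> \<le> (1 + a\<^sup>2 / (2 * real CARD('d)) * cosh a) ^ n * ?r x
     - ?r x * ((rate * (real n * (1 - g (x - y) / g 0)) - rate / q * ((\<Sum>v\<in>A. g (x - v)) + (real n)\<^sup>2 / s0\<^sup>2)) - ?X\<^sup>2 / 2
      - (?X * \<eta> / 2 + (?X * a\<^sup>2 / \<eta> / 2) * real n))"
  proof (intro diff_mono walkE_ramp l a mult_left_mono add_mono order_refl)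
    have "rate / q * ?bad \<le> rate / q * ((\<Sum>v\<in>A. g (x - v)) + (real n)\<^sup>2 / s0\<^sup>2)"
      using rate_nonneg q by (intro mult_left_mono bad) auto
    then show "rate * (real n * (1 - g (x - y) / g 0)) - rate / q * ((\<Sum>v\<in>A. g (x - v)) + (real n)\<^sup>2 / s0\<^sup>2)
       \<le> walkE y n x (\<lambda>b _. kills D b)"
      using walkE_kills_lower[of n x y D] by linarith
    show "walkE y n x (\<lambda>_ z. ?\<Delta> z) \<le> real n"
      using walkE_level_sq[OF l, of y n x "level l x"] by simp
    show "0 \<le> ?X * a\<^sup>2 / \<eta> / 2"
      using rate_nonneg q(1) \<eta> by (intro divide_nonneg_nonneg mult_nonneg_nonneg) auto
    show "0 \<le> ?r x" using r1[of x] by simp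
  qed
  also have "\<dots> = ((1 + a\<^sup>2 / (2 * real CARD('d)) * cosh a) ^ n
      - (rate * (real n * (1 - g (x - y) / g 0)) - rate / q * ((\<Sum>v\<in>A. g (x - v)) + (real n)\<^sup>2 / s0\<^sup>2))
      + (real n * rate / q)\<^sup>2 / 2 + (real n * rate / q) * ((\<eta> + a\<^sup>2 * real n / \<eta>) / 2)) * ?r x"
    by (simp add: algebra_simps add_divide_distrib)
  finally show ?thesis .
qed

end

section \<open>Crossing slabs\<close>

context annealed begin

text \<open>
  The total weight of the paths from \<open>x\<close> that reach \<open>y\<close> within \<open>n\<close> steps, for a walk with history \<open>h\<close>. The
  weight is taken over all sites of the history and of the path up to, and not including, the visit to \<open>y\<close>.
\<close>

primrec survive :: "int ^ 'd \<Rightarrow> nat \<Rightarrow> (int ^ 'd) list \<Rightarrow> int ^ 'd \<Rightarrow> real" where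
  "survive y 0 h x = (if x = y then weight phi UNIV h else 0)"
| "survive y (Suc n) h x =
     (if x = y then weight phi UNIV h else step_avg (\<lambda>e. survive y n (h @ [x]) (x + e)))"

lemma weight_le_prod:
  assumes "S \<subseteq> set b \<inter> C"
  shows "weight phi C b \<le> (\<Prod>v\<in>S. phi (count_list b v))"
proof -
  have "weight phi C b = (\<Prod>v\<in>set b \<inter> C - S. phi (count_list b v)) * (\<Prod>v\<in>S. phi (count_list b v))"
    unfolding weight_def using assms by (intro prod.subset_diff) auto
  also have "\<dots> \<le> 1 * (\<Prod>v\<in>S. phi (count_list b v))"
    using phi_nonneg phi_le_1 by (intro mult_right_mono prod_le_1 prod_nonneg) auto
  finally show ?thesis by simp
qed

text \<open>
  The substitute for multiplicativity: if the history charges sites in \<open>C\<close> and a block charges sites outside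
  \<open>C\<close>, every site is charged at most once. A charged site may be visited at other times as well, as
  \<open>phi\<close> decreases.
\<close>

lemma weight_append_le:
  assumes "C \<inter> D = {}"
  shows "weight phi (C \<union> (set b \<inter> D)) (h @ b) \<le> weight phi C h * weight phi D b"
proof -
  have "weight phi (C \<union> (set b \<inter> D)) (h @ b)
      \<le> (\<Prod>v\<in>(set h \<inter> C) \<union> (set b \<inter> D). phi (count_list (h @ b) v))"
    by (rule weight_le_prod) auto
  also have "\<dots> = (\<Prod>v\<in>set h \<inter> C. phi (count_list (h @ b) v)) * (\<Prod>v\<in>set b \<inter> D. phi (count_list (h @ b) v))"
    using assms by (intro prod.union_disjoint) auto
  also have "\<dots> \<le> weight phi C h * weight phi D b"
    unfolding weight_def using phi_nonneg
    by (intro mult_mono prod_mono conjI phi_antimono prod_nonneg) auto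
  finally show ?thesis .
qed

lemma weight_append_mono: "weight phi C (h @ b) \<le> weight phi C h"
  using weight_append_le[of C "{}" b h] by (simp add: weight_def)

lemma weight_UNIV_le: "weight phi UNIV h \<le> weight phi C h"
  by (rule order_trans[OF weight_le_prod[of "set h \<inter> C"]]) (auto simp: weight_def)

lemma survive_nonneg: "0 \<le> survive y n h x"
  by (induction n arbitrary: h x) (auto intro: step_avg_nonneg weight_range)

lemma survive_le_weight: "survive y n h x \<le> weight phi C h"
proof (induction n arbitrary: h x)
  case (Suc n)
  have "step_avg (\<lambda>e. survive y n (h @ [x]) (x + e)) \<le> step_avg (\<lambda>e :: int ^ 'd. weight phi C h)"
    by (intro step_avg_mono order_trans[OF Suc.IH] weight_append_mono)
  then show ?case using weight_UNIV_le[of h C] by auto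
qed (use weight_UNIV_le weight_range in auto)

lemma survive_Suc: "survive y n h x \<le> survive y (Suc n) h x"
proof (induction n arbitrary: h x)
  case 0
  then show ?case using survive_nonneg[of y "Suc 0" h x] by auto
next
  case (Suc n)
  have "step_avg (\<lambda>e. survive y n (h @ [x]) (x + e)) \<le> step_avg (\<lambda>e. survive y (Suc n) (h @ [x]) (x + e))"
    by (intro step_avg_mono Suc.IH)
  then show ?case by (simp only: survive.simps) (auto simp del: survive.simps)
qed

lemma survive_mono: "m \<le> n \<Longrightarrow> survive y m h x \<le> survive y n h x"
  by (rule lift_Suc_mono_le[of "\<lambda>n. survive y n h x"]) (auto intro: survive_Suc simp del: survive.simps)

lemma survive_block: "survive y (m + n) h x = walkE y m x (\<lambda>b z. survive y n (h @ b) z)"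
proof (induction m arbitrary: h x)
  case (Suc m)
  show ?case
  proof (cases "x = y")
    case True
    then show ?thesis by (cases n) simp_all
  next
    case False
    then show ?thesis using Suc.IH[of "h @ [x]"] by simp
  qed
qed simp

text \<open>
  The bound \<open>\<rho>\<^bsup>-(k-i)\<^esup> \<theta>\<^bsup>-j\<^esup> r\<^sub>i(x)\<close> holds for a walk at \<open>x\<close> that is working on the \<open>i\<close>-th slab and has completed \<open>j\<close>
  charged blocks there; \<open>C\<close> collects the charged sites, so that at most \<open>j T\<close> of them lie in the current
  slab. The walk proceeds in four ways. Near the top of the slab or beyond it, it moves on to the next slab,
  where the loss of \<open>\<rho>\<close> is paid by the growth function. After \<open>J\<close> blocks it moves on wherever it is, and
  the accumulated \<open>\<theta>\<^sup>J\<close> pays. Below the margin \<open>s0\<close> over the bottom of the slab it makes one uncharged step,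
  the growth function being flat there. Otherwise it runs a block, which gains \<open>\<theta>\<close>. The target lies above
  all slabs that are worked on, so it can be met only inside a block, where absorption takes care of it.
\<close>

lemma survive_slabs:
  fixes y :: "int ^ 'd" and l :: "real ^ 'd"
  assumes l: "norm l = 1" and a: "0 \<le> a" and T: "1 \<le> T"
    and \<theta>: "0 < \<theta>" "\<theta> \<le> 1" and \<rho>: "1 \<le> \<rho>" "\<theta> ^ J * \<rho> \<le> 1" "\<rho> \<le> cosh (a * (L - 2 * s0 - 1))"
    and s0: "0 \<le> s0" "2 * s0 + 1 \<le> L"
    and y: "real k * L \<le> level l y"
    and block: "\<And>i x A. i < k \<Longrightarrow> finite A \<Longrightarrow> card A \<le> J * T \<Longrightarrow>
      real i * L + s0 < level l x \<Longrightarrow> level l x < real (Suc i) * L - s0 \<Longrightarrow>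
      walkE y T x (\<lambda>b z. weight phi ({v. real i * L < level l v \<and> level l v \<le> real (Suc i) * L} - A) b
          * ramp a (level l z - (real i * L + s0 + 1)))
        \<le> \<theta> * ramp a (level l x - (real i * L + s0 + 1))"
  shows "survive y n [] 0 \<le> (1 / \<rho>) ^ k"
proof -
  define slab where "slab = (\<lambda>i. {v. real i * L < level l v \<and> level l v \<le> real (Suc i) * L})"
  define r where "r = (\<lambda>i x. ramp a (level l x - (real i * L + s0 + 1)))"
  define P where "P = (\<lambda>n i. \<forall>j h x C. j \<le> J \<longrightarrow> finite C \<longrightarrow>
     (\<forall>v\<in>C. level l v \<le> real (Suc i) * L) \<longrightarrow> card {v\<in>C. real i * L < level l v} \<le> j * T \<longrightarrow>
     survive y n h x \<le> weight phi C h * ((1 / \<rho>) ^ (k - i) / \<theta> ^ j * r i x))"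
  have L0: "0 < L" using s0 by linarith
  have r1: "1 \<le> r i x" for i x by (simp add: r_def ramp_ge_1)
  have coeff: "0 \<le> (1 / \<rho>) ^ m / \<theta> ^ j" for m j using \<rho> \<theta> by simp
  have step: "P n i" if "i \<le> k" and prev: "\<And>i n'. i \<le> k \<Longrightarrow> n = Suc n' \<Longrightarrow> P n' i" for n i
    using \<open>i \<le> k\<close>
  proof (induction i rule: inc_induct)
    case base
    show ?case unfolding P_def
    proof (intro allI impI)
      fix j :: nat and h :: "(int ^ 'd) list" and x :: "int ^ 'd" and C :: "(int ^ 'd) set"
      assume "finite C"
      have "1 \<le> 1 / \<theta> ^ j" using \<theta> by (simp add: power_le_one)
      then have "1 \<le> (1 / \<rho>) ^ (k - k) / \<theta> ^ j * r k x"
        using mult_mono[of 1 "1 / \<theta> ^ j" 1 "r k x"] r1[of k x] \<theta>(1) by simp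
      then have "weight phi C h * 1 \<le> weight phi C h * ((1 / \<rho>) ^ (k - k) / \<theta> ^ j * r k x)"
        by (intro mult_left_mono weight_range)
      then show "survive y n h x \<le> weight phi C h * ((1 / \<rho>) ^ (k - k) / \<theta> ^ j * r k x)"
        using survive_le_weight[of y n h x C] by simp
    qed
  next
    case (step i)
    have ik: "i < k" by fact
    have "real (Suc i) * L \<le> real k * L" using ik L0 by (intro mult_right_mono) auto
    then have yi: "real (Suc i) * L \<le> level l y" using y by linarith
    show ?case unfolding P_def
    proof (intro allI impI)
      fix j :: nat and h :: "(int ^ 'd) list" and x :: "int ^ 'd" and C :: "(int ^ 'd) set"
      assume j: "j \<le> J" and C: "finite C" "\<forall>v\<in>C. level l v \<le> real (Suc i) * L"
        "card {v\<in>C. real i * L < level l v} \<le> j * T"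
      let ?goal = "survive y n h x \<le> weight phi C h * ((1 / \<rho>) ^ (k - i) / \<theta> ^ j * r i x)"
      have next_stage: ?goal if "\<rho> * \<theta> ^ j * r (Suc i) x \<le> r i x"
      proof -
        have none: "{v\<in>C. real (Suc i) * L < level l v} = {}" using C(2) by force
        have "\<forall>v\<in>C. level l v \<le> real (Suc (Suc i)) * L"
          using C(2) L0 by (fastforce simp: distrib_right)
        then have "survive y n h x \<le> weight phi C h * ((1 / \<rho>) ^ (k - Suc i) / \<theta> ^ 0 * r (Suc i) x)"
          using step.IH C(1) none unfolding P_def by (metis (no_types, lifting) card.empty le0)
        also have "\<dots> \<le> weight phi C h * ((1 / \<rho>) ^ (k - i) / \<theta> ^ j * r i x)"
        proof (intro mult_left_mono weight_range)
          have "(1 / \<rho>) ^ (k - i) / \<theta> ^ j * (\<rho> * \<theta> ^ j * r (Suc i) x) \<le> (1 / \<rho>) ^ (k - i) / \<theta> ^ j * r i x"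
            by (intro mult_left_mono that coeff)
          moreover have "k - i = Suc (k - Suc i)" using ik by simp
          ultimately show "(1 / \<rho>) ^ (k - Suc i) / \<theta> ^ 0 * r (Suc i) x \<le> (1 / \<rho>) ^ (k - i) / \<theta> ^ j * r i x"
            using \<rho>(1) \<theta>(1) by simp
        qed
        finally show ?thesis .
      qed
      consider "real (Suc i) * L - s0 \<le> level l x" | "j = J"
        | "level l x \<le> real i * L + s0"
        | "real i * L + s0 < level l x" "level l x < real (Suc i) * L - s0" "j < J"
        using j by linarith
      then show ?goal
      proof cases
        case 1
        have "cosh (a * (L - 2 * s0 - 1)) * r (Suc i) x \<le> r i x"
          using ramp_superadditive[of a "L - 2 * s0 - 1" L "level l x - (real (Suc i) * L + s0 + 1)"] 1 a s0
          by (simp add: r_def algebra_simps)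
        moreover have "\<rho> * \<theta> ^ j * r (Suc i) x \<le> cosh (a * (L - 2 * s0 - 1)) * r (Suc i) x"
        proof (rule mult_right_mono)
          have "\<rho> * \<theta> ^ j \<le> \<rho> * 1" using \<theta> \<rho>(1) by (intro mult_left_mono power_le_one) auto
          then show "\<rho> * \<theta> ^ j \<le> cosh (a * (L - 2 * s0 - 1))" using \<rho>(3) by linarith
        qed (use r1[of "Suc i" x] in linarith)
        ultimately show ?thesis by (intro next_stage) linarith
      next
        case 2
        have "\<rho> * \<theta> ^ j * r (Suc i) x \<le> 1 * r (Suc i) x"
          using \<rho>(2) r1[of "Suc i" x] 2 by (intro mult_right_mono) (auto simp: mult.commute)
        also have "\<dots> \<le> r i x"
          using a L0 unfolding r_def by (auto intro!: ramp_mono simp: distrib_right)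
        finally show ?thesis by (rule next_stage)
      next
        case 3
        have xy: "x \<noteq> y" using 3 yi s0 by (auto simp: distrib_right)
        have rhs: "0 \<le> weight phi C h * ((1 / \<rho>) ^ (k - i) / \<theta> ^ j * r i x)"
          using coeff[of "k - i" j] r1[of i x] by (intro mult_nonneg_nonneg weight_range) auto
        show ?thesis
        proof (cases n)
          case 0
          then show ?thesis using xy rhs by simp
        next
          case (Suc n')
          have rx: "r i x = 1" using 3 by (simp add: r_def ramp_nonpos)
          have "survive y n' (h @ [x]) (x + e) \<le> weight phi C h * ((1 / \<rho>) ^ (k - i) / \<theta> ^ j * r i x)"
            if e: "e \<in> unit_steps" for e
          proof -
            have re: "r i (x + e) = 1"
              using 3 abs_level_step[OF l e] by (auto simp: r_def level_add intro!: ramp_nonpos)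
            have "survive y n' (h @ [x]) (x + e) \<le> weight phi C (h @ [x]) * ((1 / \<rho>) ^ (k - i) / \<theta> ^ j * r i (x + e))"
              using prev[of i n'] ik Suc j C unfolding P_def by auto
            also have "\<dots> \<le> weight phi C h * ((1 / \<rho>) ^ (k - i) / \<theta> ^ j * r i x)"
              unfolding re rx using coeff by (intro mult_right_mono weight_append_mono) auto
            finally show ?thesis .
          qed
          then have "step_avg (\<lambda>e. survive y n' (h @ [x]) (x + e))
              \<le> step_avg (\<lambda>e :: int ^ 'd. weight phi C h * ((1 / \<rho>) ^ (k - i) / \<theta> ^ j * r i x))"
            by (rule step_avg_mono)
          then show ?thesis using Suc xy by simp
        qed
      next
        case 4
        have xy: "x \<noteq> y" using 4 yi s0 by auto
        have rhs: "0 \<le> weight phi C h * ((1 / \<rho>) ^ (k - i) / \<theta> ^ j * r i x)"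
          using coeff[of "k - i" j] r1[of i x] by (intro mult_nonneg_nonneg weight_range) auto
        show ?thesis
        proof (cases n)
          case 0
          then show ?thesis using xy rhs by simp
        next
          case (Suc n')
          define A where "A = {v\<in>C. real i * L < level l v}"
          define D where "D = slab i - A"
          let ?c = "(1 / \<rho>) ^ (k - i) / \<theta> ^ Suc j"
          have CD: "C \<inter> D = {}" by (auto simp: D_def A_def slab_def)
          have inner: "survive y n' (h @ b) z \<le> (weight phi C h * ?c) * (weight phi D b * r i z)"
            if b: "length b \<le> T" for b z
          proof -
            let ?C = "C \<union> (set b \<inter> D)"
            have "{v\<in>?C. real i * L < level l v} \<subseteq> A \<union> set b" by (auto simp: A_def)
            then have "card {v\<in>?C. real i * L < level l v} \<le> card (A \<union> set b)"
              using C(1) by (intro card_mono) (auto simp: A_def)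
            also have "\<dots> \<le> card A + card (set b)" by (rule card_Un_le)
            also have "\<dots> \<le> j * T + T"
              using C(3) card_length[of b] b by (intro add_mono) (auto simp: A_def)
            finally have "card {v\<in>?C. real i * L < level l v} \<le> Suc j * T" by simp
            moreover have "\<forall>v\<in>?C. level l v \<le> real (Suc i) * L"
              using C(2) by (auto simp: D_def slab_def)
            moreover have "finite ?C" "Suc j \<le> J" using C(1) 4(3) by auto
            moreover have "P n' i" using prev[of i n'] ik Suc by simp
            ultimately have "survive y n' (h @ b) z \<le> weight phi ?C (h @ b) * (?c * r i z)"
              unfolding P_def by blast
            also have "\<dots> \<le> (weight phi C h * weight phi D b) * (?c * r i z)"
              using coeff[of "k - i" "Suc j"] r1[of i z]
              by (intro mult_right_mono weight_append_le CD mult_nonneg_nonneg) auto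
            finally show ?thesis by (simp add: mult_ac)
          qed
          \<comment> \<open>a horizon that allows a full block plus an instance of the induction hypothesis\<close>
          have "survive y n h x \<le> survive y (T + n') h x"
            using Suc T by (intro survive_mono) auto
          also have "\<dots> = walkE y T x (\<lambda>b z. survive y n' (h @ b) z)" by (rule survive_block)
          also have "\<dots> \<le> walkE y T x (\<lambda>b z. (weight phi C h * ?c) * (weight phi D b * r i z))"
            by (intro walkE_mono inner)
          also have "\<dots> = (weight phi C h * ?c) * walkE y T x (\<lambda>b z. weight phi D b * r i z)"
            by (rule walkE_cmult)
          also have "\<dots> \<le> (weight phi C h * ?c) * (\<theta> * r i x)"
          proof (rule mult_left_mono)
            have "card A \<le> J * T" using C(3) j by (metis A_def mult_le_mono1 order_trans)
            then show "walkE y T x (\<lambda>b z. weight phi D b * r i z) \<le> \<theta> * r i x"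
              using block[OF ik _ _ 4(1,2), of A] C(1) by (simp add: D_def slab_def r_def A_def)
            show "0 \<le> weight phi C h * ?c" using coeff by (intro mult_nonneg_nonneg weight_range)
          qed
          also have "\<dots> = weight phi C h * ((1 / \<rho>) ^ (k - i) / \<theta> ^ j * r i x)"
            using \<theta>(1) by simp
          finally show ?thesis .
        qed
      qed
    qed
  qed
  have "P n i" if "i \<le> k" for n i
    using that
  proof (induction n arbitrary: i)
    case 0
    then show ?case by (rule step) simp
  next
    case (Suc n)
    show ?case
    proof (rule step[OF Suc.prems])
      fix i n' assume "i \<le> k" "Suc n = Suc n'"
      then have "n' = n" by simp
      with Suc.IH[OF \<open>i \<le> k\<close>] show "P n' i" by (simp only:)
    qed
  qed
  then have P0: "P n 0" by simp
  have "survive y n [] 0 \<le> weight phi ({} :: (int ^ 'd) set) [] * ((1 / \<rho>) ^ (k - 0) / \<theta> ^ 0 * r 0 0)"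
    using P0[unfolded P_def, THEN spec, of 0, THEN spec, of "[]", THEN spec, of 0, THEN spec, of "{}"] by simp
  moreover have "level l 0 = 0"
    using level_add[of l 0 0] by simp
  then have "r 0 0 = 1" using s0 unfolding r_def by (intro ramp_nonpos) simp
  ultimately show ?thesis by (simp add: weight_def)
qed

end

section \<open>Finite-dimensional expectations under the random walk law\<close>

abbreviation path_space :: "(nat \<Rightarrow> int ^ 'd::finite) measure" where
  "path_space \<equiv> PiM UNIV (\<lambda>_. count_space UNIV)"

abbreviation step_law :: "(int ^ 'd::finite) measure" where
  "step_law \<equiv> measure_pmf (pmf_of_set unit_steps)"

lemma sets_step_sequences:
  "sets (PiM UNIV (\<lambda>_::nat. step_law :: (int ^ 'd::finite) measure)) = sets path_space"
  by (rule sets_PiM_cong) auto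

lemma measurable_coordinate [measurable]: "(\<lambda>S. S n) \<in> measurable path_space (count_space UNIV)"
  by (rule measurable_component_singleton) simp

lemma measurable_partial_sums:
  "(\<lambda>\<xi> n. x + (\<Sum>i<n. \<xi> i)) \<in> measurable path_space (path_space :: (nat \<Rightarrow> int ^ 'd::finite) measure)"
proof (rule measurable_PiM_single')
  fix n :: nat
  show "(\<lambda>\<xi> :: nat \<Rightarrow> int ^ 'd. x + (\<Sum>i<n. \<xi> i)) \<in> measurable path_space (count_space UNIV)"
  proof (induction n)
    case (Suc n)
    have "(\<lambda>\<xi>. (x + (\<Sum>i<n. \<xi> i)) + \<xi> n) \<in> measurable (path_space :: (nat \<Rightarrow> int ^ 'd) measure) (count_space UNIV)"
      by (rule measurable_compose_countable[where f = "\<lambda>a \<xi>. a + \<xi> n",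
            OF measurable_compose[OF measurable_coordinate] Suc]) simp
    then show ?case by (simp add: add.assoc)
  qed simp
qed auto

lemma sets_srw_law [simp, measurable_cong]: "sets (srw_law x) = sets path_space"
  by (simp add: srw_law_def)

lemma space_srw_law [simp]: "space (srw_law x) = UNIV"
  by (simp add: srw_law_def space_PiM PiE_UNIV_domain)

lemma nn_integral_srw_law:
  assumes "G \<in> borel_measurable path_space"
  shows "(\<integral>\<^sup>+ S. G S \<partial>srw_law x) = (\<integral>\<^sup>+ \<xi>. G (\<lambda>n. x + (\<Sum>i<n. \<xi> i)) \<partial>PiM UNIV (\<lambda>_. step_law))"
  unfolding srw_law_def
  using measurable_partial_sums[of x] assms
  by (intro nn_integral_distr) (simp_all cong: measurable_cong_sets add: sets_step_sequences)

text \<open>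
  The Markov property at time 1, from the splitting of the product measure of the steps into its first factor
  and the shifted sequence.
\<close>

lemma nn_integral_srw_law_step:
  fixes x :: "int ^ 'd::finite"
  assumes G: "G \<in> borel_measurable path_space"
  shows "(\<integral>\<^sup>+ S. G S \<partial>srw_law x)
    = (\<Sum>e\<in>unit_steps. \<integral>\<^sup>+ S. G (case_nat x S) \<partial>srw_law (x + e)) / ennreal (2 * real CARD('d))"
proof -
  let ?P = "PiM UNIV (\<lambda>_::nat. step_law :: (int ^ 'd) measure)"
  interpret sequence_space "step_law :: (int ^ 'd) measure" by unfold_locales
  have cons: "(\<lambda>S. case_nat x S) \<in> measurable path_space (path_space :: (nat \<Rightarrow> int ^ 'd) measure)" for x :: "int ^ 'd"
    by (rule measurable_PiM_single') (auto split: nat.split simp: space_PiM)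
  have Gsum: "(\<lambda>\<xi>. G (\<lambda>n. x + (\<Sum>i<n. \<xi> i))) \<in> borel_measurable ?P"
    using measurable_compose[OF measurable_partial_sums[of x] G]
    by (simp cong: measurable_cong_sets add: sets_step_sequences)
  have "(\<integral>\<^sup>+ S. G S \<partial>srw_law x) = (\<integral>\<^sup>+ \<xi>. G (\<lambda>n. x + (\<Sum>i<n. \<xi> i)) \<partial>?P)"
    by (rule nn_integral_srw_law[OF G])
  also have "\<dots> = (\<integral>\<^sup>+ \<xi>. G (\<lambda>n. x + (\<Sum>i<n. \<xi> i)) \<partial>distr (step_law \<Otimes>\<^sub>M ?P) ?P (\<lambda>(s, \<omega>). case_nat s \<omega>))"
    by (simp add: PiM_iter)
  also have "\<dots> = (\<integral>\<^sup>+ p. G (\<lambda>n. x + (\<Sum>i<n. (case p of (s, \<omega>) \<Rightarrow> case_nat s \<omega>) i)) \<partial>(step_law \<Otimes>\<^sub>M ?P))"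
    by (rule nn_integral_distr) (use Gsum in measurable)
  also have "\<dots> = (\<integral>\<^sup>+ e. \<integral>\<^sup>+ \<xi>. G (\<lambda>n. x + (\<Sum>i<n. case_nat e \<xi> i)) \<partial>?P \<partial>step_law)"
    using measurable_compose[OF _ Gsum, of "\<lambda>(s, \<omega>). case_nat s \<omega>" "step_law \<Otimes>\<^sub>M ?P"]
    by (subst nn_integral_fst[symmetric]) (auto simp: case_prod_beta')
  also have "\<dots> = (\<integral>\<^sup>+ e. (\<integral>\<^sup>+ S. G (case_nat x S) \<partial>srw_law (x + e)) \<partial>step_law)"
  proof (rule nn_integral_cong)
    fix e :: "int ^ 'd"
    have "(\<lambda>n. x + (\<Sum>i<n. case_nat e \<xi> i)) = case_nat x (\<lambda>n. (x + e) + (\<Sum>i<n. \<xi> i))" for \<xi>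
    proof
      fix n show "x + (\<Sum>i<n. case_nat e \<xi> i) = case_nat x (\<lambda>n. (x + e) + (\<Sum>i<n. \<xi> i)) n"
        by (cases n) (simp_all add: sum.lessThan_Suc_shift add.assoc del: sum.lessThan_Suc)
    qed
    then show "(\<integral>\<^sup>+ \<xi>. G (\<lambda>n. x + (\<Sum>i<n. case_nat e \<xi> i)) \<partial>?P) = (\<integral>\<^sup>+ S. G (case_nat x S) \<partial>srw_law (x + e))"
      by (subst nn_integral_srw_law) (use measurable_compose[OF cons G] in auto)
  qed
  also have "\<dots> = (\<Sum>e\<in>unit_steps. \<integral>\<^sup>+ S. G (case_nat x S) \<partial>srw_law (x + e)) / ennreal (2 * real CARD('d))"
    by (subst nn_integral_pmf_of_set[OF unit_steps_nonempty finite_unit_steps])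
       (simp add: card_unit_steps ennreal_of_nat_eq_real_of_nat)
  finally show ?thesis .
qed

lemma ennreal_step_avg:
  fixes f :: "int ^ 'd::finite \<Rightarrow> real"
  assumes "\<And>e. e \<in> unit_steps \<Longrightarrow> 0 \<le> f e"
  shows "(\<Sum>e\<in>unit_steps. ennreal (f e)) / ennreal (2 * real CARD('d)) = ennreal (step_avg f)"
  using assms by (simp add: step_avg_def sum_ennreal divide_ennreal sum_nonneg)

text \<open>
  The list passed to \<open>F\<close> contains all positions, including the final one.
\<close>

primrec pathE :: "nat \<Rightarrow> int ^ 'd::finite \<Rightarrow> ((int ^ 'd) list \<Rightarrow> int ^ 'd \<Rightarrow> real) \<Rightarrow> real" where
  "pathE 0 x F = F [x] x"
| "pathE (Suc n) x F = step_avg (\<lambda>e. pathE n (x + e) (\<lambda>p z. F (x # p) z))"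

lemma pathE_nonneg: "(\<And>p z. 0 \<le> F p z) \<Longrightarrow> 0 \<le> pathE n x F"
  by (induction n arbitrary: x F) (auto intro!: step_avg_nonneg)

lemma measurable_initial_path:
  "(\<lambda>S. map S [0..<n]) \<in> measurable (path_space :: (nat \<Rightarrow> int ^ 'd::finite) measure) (count_space UNIV)"
proof (induction n)
  case (Suc n)
  have "(\<lambda>S. map S [0..<n] @ [S n]) \<in> measurable (path_space :: (nat \<Rightarrow> int ^ 'd) measure) (count_space UNIV)"
    using measurable_compose_countable[OF _ Suc, where f = "\<lambda>p S. p @ [S n]"]
      measurable_compose[OF measurable_coordinate[of n]] by auto
  then show ?case by simp
qed simp

lemma measurable_path_functional:
  "(\<lambda>S. F (map S [0..<n]) (S m)) \<in> borel_measurable (path_space :: (nat \<Rightarrow> int ^ 'd::finite) measure)"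
  by (rule measurable_compose_countable[OF _ measurable_initial_path])
     (rule measurable_compose[OF measurable_coordinate], simp)

lemma nn_integral_srw_pathE:
  fixes x :: "int ^ 'd::finite"
  assumes "\<And>p z. 0 \<le> F p z"
  shows "(\<integral>\<^sup>+ S. ennreal (F (map S [0..<Suc n]) (S n)) \<partial>srw_law x) = ennreal (pathE n x F)"
  using assms
proof (induction n arbitrary: x F)
  case 0
  interpret prob_space "srw_law x" by (rule prob_space_srw_law)
  have "(\<integral>\<^sup>+ S. ennreal (F (map S [0..<Suc 0]) (S 0)) \<partial>srw_law x)
     = (\<integral>\<^sup>+ \<xi>. ennreal (F [x] x) \<partial>PiM UNIV (\<lambda>_ :: nat. step_law :: (int ^ 'd) measure))"
    using measurable_path_functional[of "\<lambda>p z. ennreal (F p z)" "Suc 0" 0]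
    by (subst nn_integral_srw_law) simp_all
  also have "\<dots> = ennreal (F [x] x)"
  proof -
    interpret sequence_space "step_law :: (int ^ 'd) measure" by unfold_locales
    show ?thesis by (simp add: P.emeasure_space_1)
  qed
  finally show ?case by simp
next
  case (Suc n)
  have map_case: "map (case_nat x S) [0..<Suc (Suc n)] = x # map S [0..<Suc n]" for S :: "nat \<Rightarrow> int ^ 'd"
    by (subst upt_conv_Cons) (simp_all add: map_Suc_upt[symmetric] del: upt_Suc)
  have "(\<integral>\<^sup>+ S. ennreal (F (map S [0..<Suc (Suc n)]) (S (Suc n))) \<partial>srw_law x)
     = (\<Sum>e\<in>unit_steps. \<integral>\<^sup>+ S. ennreal (F (x # map S [0..<Suc n]) (S n)) \<partial>srw_law (x + e)) / ennreal (2 * real CARD('d))"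
    using measurable_path_functional[of "\<lambda>p z. ennreal (F p z)" "Suc (Suc n)" "Suc n"]
    by (subst nn_integral_srw_law_step) (simp_all add: map_case del: upt_Suc)
  also have "\<dots> = (\<Sum>e\<in>unit_steps. ennreal (pathE n (x + e) (\<lambda>p z. F (x # p) z))) / ennreal (2 * real CARD('d))"
    using Suc.IH[of "\<lambda>p z. F (x # p) z"] Suc.prems by simp
  also have "\<dots> = ennreal (pathE (Suc n) x F)"
    using Suc.prems by (subst ennreal_step_avg) (auto intro: pathE_nonneg)
  finally show ?case .
qed

section \<open>The escape probability\<close>

lemma hit_prob_range: "0 \<le> hit_prob n z" "hit_prob n z \<le> 1"
proof -
  show "0 \<le> hit_prob n z" by (induction n arbitrary: z) (auto intro: step_avg_nonneg)
  show "hit_prob n z \<le> 1" by (rule hit_prob_le_superharmonic) auto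
qed

lemma avoid_sets: "{S. \<forall>k<n. S k \<noteq> 0} \<in> sets (path_space :: (nat \<Rightarrow> int ^ 'd::finite) measure)"
proof -
  have "{S \<in> space path_space. \<forall>k<n. S k \<noteq> (0 :: int ^ 'd)} \<in> sets path_space"
    by measurable
  then show ?thesis by (simp add: space_PiM PiE_UNIV_domain)
qed

lemma nn_integral_avoid:
  fixes z :: "int ^ 'd::finite"
  shows "(\<integral>\<^sup>+ S. indicator {S. \<forall>k<n. S k \<noteq> 0} S \<partial>srw_law z) = ennreal (1 - hit_prob n z)"
proof (induction n arbitrary: z)
  case 0
  interpret prob_space "srw_law z" by (rule prob_space_srw_law)
  show ?case using emeasure_space_1 by simp
next
  case (Suc n)
  have ind: "indicator {S. \<forall>k<Suc n. S k \<noteq> 0} (case_nat z S)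
      = (if z = 0 then 0 else indicator {S. \<forall>k<n. S k \<noteq> 0} S :: ennreal)" for S :: "nat \<Rightarrow> int ^ 'd"
    by (auto simp: indicator_def All_less_Suc2)
  have "(\<integral>\<^sup>+ S. indicator {S. \<forall>k<Suc n. S k \<noteq> 0} S \<partial>srw_law z)
    = (\<Sum>e\<in>unit_steps. \<integral>\<^sup>+ S. (if z = 0 then 0 else indicator {S. \<forall>k<n. S k \<noteq> 0} S) \<partial>srw_law (z + e)) / ennreal (2 * real CARD('d))"
    by (subst nn_integral_srw_law_step) (use avoid_sets in \<open>simp_all add: ind\<close>)
  also have "\<dots> = (\<Sum>e\<in>unit_steps. ennreal (if z = 0 then 0 else 1 - hit_prob n (z + e))) / ennreal (2 * real CARD('d))"
    by (cases "z = 0") (simp_all add: Suc.IH)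
  also have "\<dots> = ennreal (step_avg (\<lambda>e. if z = 0 then 0 else 1 - hit_prob n (z + e)))"
    using hit_prob_range by (intro ennreal_step_avg) auto
  also have "step_avg (\<lambda>e. if z = 0 then 0 else 1 - hit_prob n (z + e)) = 1 - hit_prob (Suc n) z"
    by (auto simp: step_avg_diff)
  finally show ?case .
qed

lemma measure_no_return:
  "measure (srw_law (0 :: int ^ 'd::finite)) {S. \<forall>k. 1 \<le> k \<and> k \<le> n \<longrightarrow> S k \<noteq> 0} = 1 - step_avg (\<lambda>e :: int ^ 'd. hit_prob n e)"
  and sets_no_return: "{S. \<forall>k. 1 \<le> k \<and> k \<le> n \<longrightarrow> S k \<noteq> (0 :: int ^ 'd)} \<in> sets path_space"
proof -
  let ?E = "{S :: nat \<Rightarrow> int ^ 'd. \<forall>k. 1 \<le> k \<and> k \<le> n \<longrightarrow> S k \<noteq> 0}"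
  have "{S \<in> space path_space. \<forall>k. 1 \<le> k \<and> k \<le> n \<longrightarrow> S k \<noteq> (0 :: int ^ 'd)} \<in> sets path_space"
    by measurable
  then show sets: "?E \<in> sets path_space" by (simp add: space_PiM PiE_UNIV_domain)
  have ind: "indicator ?E (case_nat 0 S) = (indicator {S. \<forall>k<n. S k \<noteq> 0} S :: ennreal)" for S
  proof -
    have "(\<forall>k. 1 \<le> k \<and> k \<le> n \<longrightarrow> case_nat 0 S k \<noteq> (0 :: int ^ 'd)) \<longleftrightarrow> (\<forall>k<n. S k \<noteq> 0)"
    proof safe
      fix k assume "\<forall>k. 1 \<le> k \<and> k \<le> n \<longrightarrow> case_nat 0 S k \<noteq> (0 :: int ^ 'd)" "k < n" "S k = 0"
      then show False by (auto dest!: spec[of _ "Suc k"])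
    next
      fix k assume "\<forall>k<n. S k \<noteq> 0" "1 \<le> k" "k \<le> n" "case_nat 0 S k = (0 :: int ^ 'd)"
      then show False by (cases k) auto
    qed
    then show ?thesis by (simp add: indicator_def)
  qed
  have "emeasure (srw_law 0) ?E = (\<integral>\<^sup>+ S. indicator ?E S \<partial>srw_law 0)"
    using sets by (simp add: nn_integral_indicator)
  also have "\<dots> = (\<Sum>e\<in>(unit_steps :: (int ^ 'd) set). ennreal (1 - hit_prob n e)) / ennreal (2 * real CARD('d))"
  proof (subst nn_integral_srw_law_step)
    show "indicator ?E \<in> borel_measurable path_space" using sets by (rule borel_measurable_indicator)
  qed (simp only: ind nn_integral_avoid add_0_left)
  also have "\<dots> = ennreal (step_avg (\<lambda>e :: int ^ 'd. 1 - hit_prob n e))"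
    using hit_prob_range by (intro ennreal_step_avg) auto
  finally have "measure (srw_law 0) ?E = step_avg (\<lambda>e :: int ^ 'd. 1 - hit_prob n e)"
    using hit_prob_range by (intro measure_eq_emeasure_eq_ennreal step_avg_nonneg) auto
  then show "measure (srw_law 0) ?E = 1 - step_avg (\<lambda>e :: int ^ 'd. hit_prob n e)"
    by (simp add: step_avg_diff)
qed

text \<open>
  The function \<open>g / g 0\<close> dominates the hitting probability of 0, and one step away from 0 its mean is at most
  \<open>1 - 1 / g 0\<close>; so \<open>q \<ge> 1 / g 0\<close>.
\<close>

lemma escape_prob_bounds:
  fixes g :: "int ^ 'd::finite \<Rightarrow> real"
  assumes g: "green_majorant g"
  shows "0 < escape_prob TYPE('d)" "escape_prob TYPE('d) \<le> 1"
    "step_avg (\<lambda>e :: int ^ 'd. hit_prob n e) \<le> 1 - escape_prob TYPE('d)"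
proof -
  interpret prob_space "srw_law (0 :: int ^ 'd)" by (rule prob_space_srw_law)
  let ?E = "\<lambda>n. {S :: nat \<Rightarrow> int ^ 'd. \<forall>k. 1 \<le> k \<and> k \<le> n \<longrightarrow> S k \<noteq> 0}"
  have esc: "escape_prob TYPE('d) = prob (\<Inter>n. ?E n)"
    unfolding escape_prob_def by (rule arg_cong[where f = prob]) auto
  show "escape_prob TYPE('d) \<le> 1" unfolding esc by (rule prob_le_1)
  have "escape_prob TYPE('d) \<le> prob (?E n)"
    unfolding esc using sets_no_return by (intro finite_measure_mono) auto
  then show "step_avg (\<lambda>e :: int ^ 'd. hit_prob n e) \<le> 1 - escape_prob TYPE('d)"
    unfolding measure_no_return by linarith
  have g0: "0 < g 0" and gs: "step_avg (\<lambda>e. g (x + e)) + (if x = 0 then 1 else 0) \<le> g x" and gp: "0 < g x" for x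
    using g by (auto simp: green_majorant_def)
  have "1 / g 0 \<le> prob (?E n)" for n
  proof -
    have "hit_prob n e \<le> g e / g 0" for n and e :: "int ^ 'd"
    proof (rule hit_prob_le_superharmonic)
      show "step_avg (\<lambda>e. g (z + e) / g 0) \<le> g z / g 0" for z
        using gs[of z] g0 step_avg_cmult[of "1 / g 0" "\<lambda>e. g (z + e)"]
        by (simp add: divide_right_mono split: if_splits)
      show "1 \<le> g 0 / g 0" using g0 by simp
      show "0 \<le> g z / g 0" for z using gp[of z] g0 by simp
    qed
    then have "step_avg (\<lambda>e :: int ^ 'd. hit_prob n e) \<le> step_avg (\<lambda>e. (1 / g 0) * g (0 + e))"
      by (intro step_avg_mono) simp
    also have "\<dots> = (1 / g 0) * step_avg (\<lambda>e. g (0 + e))" by (rule step_avg_cmult)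
    also have "\<dots> \<le> (1 / g 0) * (g 0 - 1)"
      using gs[of 0] g0 by (intro mult_left_mono) auto
    also have "\<dots> = 1 - 1 / g 0" using g0 by (simp add: field_simps)
    finally show ?thesis unfolding measure_no_return by linarith
  qed
  moreover have "(\<lambda>n. prob (?E n)) \<longlonglongrightarrow> prob (\<Inter>n. ?E n)"
    using sets_no_return by (intro finite_Lim_measure_decseq) (auto simp: decseq_def)
  ultimately have "1 / g 0 \<le> escape_prob TYPE('d)"
    unfolding esc by (intro LIMSEQ_le_const) auto
  moreover have "0 < 1 / g 0" using g0 by simp
  ultimately show "0 < escape_prob TYPE('d)" by linarith
qed

section \<open>From the Green function to absorbed walks\<close>

context annealed begin

text \<open>
  The expected weight collected at the visits to \<open>y\<close> up to time \<open>n\<close>, the weight at each visit including that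
  visit.
\<close>

primrec green_upto :: "int ^ 'd \<Rightarrow> nat \<Rightarrow> (int ^ 'd) list \<Rightarrow> int ^ 'd \<Rightarrow> real" where
  "green_upto y 0 h x = (if x = y then weight phi UNIV (h @ [x]) else 0)"
| "green_upto y (Suc n) h x = (if x = y then weight phi UNIV (h @ [x]) else 0)
     + step_avg (\<lambda>e. green_upto y n (h @ [x]) (x + e))"

lemma green_upto_le_majorant: "green_upto y n h x \<le> weight phi UNIV h * g (x - y)"
proof (induction n arbitrary: h x)
  case 0
  have "0 \<le> step_avg (\<lambda>e. g (0 + e))" by (rule step_avg_nonneg) (use g_pos in \<open>auto intro: less_imp_le\<close>)
  then have "1 \<le> g 0" using g_super[of 0] by simp
  then have "weight phi UNIV (h @ [y]) * 1 \<le> weight phi UNIV h * g 0"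
    by (intro mult_mono weight_append_mono weight_range) auto
  then show ?case using g_pos[of "x - y"] weight_range(1)[of UNIV h] by (simp add: less_imp_le)
next
  case (Suc n)
  have "step_avg (\<lambda>e. green_upto y n (h @ [x]) (x + e)) \<le> step_avg (\<lambda>e. weight phi UNIV h * g (x - y + e))"
  proof (rule step_avg_mono)
    fix e
    have "green_upto y n (h @ [x]) (x + e) \<le> weight phi UNIV (h @ [x]) * g (x + e - y)" by (rule Suc.IH)
    also have "\<dots> \<le> weight phi UNIV h * g (x - y + e)"
      using g_pos by (auto simp: diff_add_eq intro!: mult_right_mono weight_append_mono less_imp_le)
    finally show "green_upto y n (h @ [x]) (x + e) \<le> weight phi UNIV h * g (x - y + e)" .
  qed
  also have "\<dots> = weight phi UNIV h * step_avg (\<lambda>e. g (x - y + e))" by (rule step_avg_cmult)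
  finally have "green_upto y (Suc n) h x \<le> weight phi UNIV h * (if x - y = 0 then 1 else 0)
      + weight phi UNIV h * step_avg (\<lambda>e. g (x - y + e))"
    using weight_append_mono[of UNIV h "[x]"] by auto
  also have "\<dots> \<le> weight phi UNIV h * g (x - y)"
    using mult_left_mono[OF g_super[of "x - y"] weight_range(1)[of UNIV h]] by (simp add: distrib_left add.commute)
  finally show ?case .
qed

text \<open>
  After the first visit to \<open>y\<close> the weight can only decrease, and the expected number of visits to \<open>y\<close> is at
  most \<open>g 0\<close>.
\<close>

lemma green_upto_le_survive: "green_upto y n h x \<le> g 0 * survive y n h x"
proof (cases "x = y")
  case True
  then show ?thesis using green_upto_le_majorant[of y n h x] by (cases n) (simp_all add: mult.commute)
next
  case False
  then show ?thesis
  proof (induction n arbitrary: h x)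
    case (Suc n)
    have "green_upto y n (h @ [x]) (x + e) \<le> g 0 * survive y n (h @ [x]) (x + e)" for e
    proof (cases "x + e = y")
      case True
      then show ?thesis using green_upto_le_majorant[of y n "h @ [x]" "x + e"]
        by (cases n) (simp_all add: mult.commute)
    next
      case False
      then show ?thesis by (rule Suc.IH)
    qed
    then have "step_avg (\<lambda>e. green_upto y n (h @ [x]) (x + e)) \<le> step_avg (\<lambda>e. g 0 * survive y n (h @ [x]) (x + e))"
      by (intro step_avg_mono)
    then show ?case using Suc.prems by (simp add: step_avg_cmult)
  qed simp
qed

lemma sum_pathE:
  "(\<Sum>n\<le>m. pathE n x (\<lambda>p z. if z = y then weight phi UNIV (h @ p) else 0)) = green_upto y m h x"
proof (induction m arbitrary: h x)
  case (Suc m)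
  have "(\<Sum>n\<le>Suc m. pathE n x (\<lambda>p z. if z = y then weight phi UNIV (h @ p) else 0))
    = (if x = y then weight phi UNIV (h @ [x]) else 0)
      + (\<Sum>n\<le>m. step_avg (\<lambda>e. pathE n (x + e) (\<lambda>p z. if z = y then weight phi UNIV ((h @ [x]) @ p) else 0)))"
  proof -
    have "(\<lambda>p z. if z = y then weight phi UNIV (h @ x # p) else 0)
        = (\<lambda>p z. if z = y then weight phi UNIV ((h @ [x]) @ p) else 0)"
      by (intro ext) auto
    then show ?thesis by (subst sum.atMost_Suc_shift) (simp only: pathE.simps)
  qed
  also have "(\<Sum>n\<le>m. step_avg (\<lambda>e. pathE n (x + e) (\<lambda>p z. if z = y then weight phi UNIV ((h @ [x]) @ p) else 0)))
    = step_avg (\<lambda>e. \<Sum>n\<le>m. pathE n (x + e) (\<lambda>p z. if z = y then weight phi UNIV ((h @ [x]) @ p) else 0))"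
    unfolding step_avg_def sum_divide_distrib[symmetric] by (subst sum.swap) simp
  also have "\<dots> = step_avg (\<lambda>e. green_upto y m (h @ [x]) (x + e))"
    by (simp only: Suc.IH)
  finally show ?case by simp
qed simp

end

lemma nn_integral_pathE:
  assumes "\<And>\<omega> p z. 0 \<le> F \<omega> p z" "\<And>p z. (\<lambda>\<omega>. F \<omega> p z) \<in> borel_measurable M"
    and "\<And>p z. (\<integral>\<^sup>+ \<omega>. ennreal (F \<omega> p z) \<partial>M) = ennreal (G p z)" "\<And>p z. 0 \<le> G p z"
  shows "(\<lambda>\<omega>. pathE n x (F \<omega>)) \<in> borel_measurable M \<and>
    (\<integral>\<^sup>+ \<omega>. ennreal (pathE n x (F \<omega>)) \<partial>M) = ennreal (pathE n (x :: int ^ 'd::finite) G)"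
  using assms
proof (induction n arbitrary: x F G)
  case (Suc n)
  let ?F = "\<lambda>e \<omega>. pathE n (x + e) (\<lambda>p z. F \<omega> (x # p) z)"
  have IH: "?F e \<in> borel_measurable M"
    "(\<integral>\<^sup>+ \<omega>. ennreal (?F e \<omega>) \<partial>M) = ennreal (pathE n (x + e) (\<lambda>p z. G (x # p) z))" for e
    using Suc.IH[of "\<lambda>\<omega> p z. F \<omega> (x # p) z" "\<lambda>p z. G (x # p) z" "x + e"] Suc.prems by auto
  have nonneg: "0 \<le> ?F e \<omega>" "0 \<le> pathE n (x + e) (\<lambda>p z. G (x # p) z)" for e \<omega>
    using Suc.prems by (auto intro: pathE_nonneg)
  have "(\<lambda>\<omega>. pathE (Suc n) x (F \<omega>)) \<in> borel_measurable M"
    using IH(1) by (simp add: step_avg_def)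
  moreover have "(\<integral>\<^sup>+ \<omega>. ennreal (pathE (Suc n) x (F \<omega>)) \<partial>M)
      = (\<integral>\<^sup>+ \<omega>. (\<Sum>e\<in>unit_steps. ennreal (?F e \<omega>)) / ennreal (2 * real CARD('d)) \<partial>M)"
    using nonneg by (subst ennreal_step_avg) auto
  moreover have "\<dots> = (\<Sum>e\<in>unit_steps. ennreal (pathE n (x + e) (\<lambda>p z. G (x # p) z))) / ennreal (2 * real CARD('d))"
    using IH by (simp add: nn_integral_divide nn_integral_sum)
  moreover have "\<dots> = ennreal (pathE (Suc n) x G)"
    using nonneg by (subst ennreal_step_avg) auto
  ultimately show ?case by simp
qed auto

section \<open>Choice of the block length and the slab width\<close>

lemma cosh_near_zero:
  assumes "0 < (c::real)"
  obtains a0 where "0 < a0" "\<And>a. 0 \<le> a \<Longrightarrow> a \<le> a0 \<Longrightarrow> cosh a \<le> 1 + c"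
proof -
  have "isCont cosh (0::real)" by (intro continuous_intros)
  then have "\<forall>\<^sub>F a in at (0::real). dist (cosh a) (cosh 0) < c"
    using assms unfolding isCont_def tendsto_iff by blast
  then obtain e where e: "e > 0" "\<And>a::real. a \<noteq> 0 \<Longrightarrow> \<bar>a\<bar> < e \<Longrightarrow> \<bar>cosh a - 1\<bar> < c"
    by (auto simp: eventually_at dist_real_def)
  show ?thesis
  proof (rule that[of "e / 2"])
    show "cosh a \<le> 1 + c" if "0 \<le> a" "a \<le> e / 2" for a
      using e(1) e(2)[of a] that assms by (cases "a = 0") auto
  qed (use e in simp)
qed

text \<open>
  With \<open>\<delta>' = T I\<close>, the growth contributes at most \<open>(1 - \<epsilon>/2) \<delta>'\<close> to first order and the killing at least
  \<open>(1 - \<epsilon>/16) \<delta>'\<close>. The choice of \<open>\<eta>\<close> costs \<open>\<epsilon> \<delta>'/16\<close>, and the terms quadratic in \<open>\<delta>'\<close> are again below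
  \<open>\<epsilon> \<delta>'/16\<close> by the choice of \<open>\<delta>\<close>.
\<close>

lemma block_factor_bound:
  fixes \<epsilon> q d \<delta> \<eta> I :: real
  assumes \<epsilon>: "0 < \<epsilon>" "\<epsilon> \<le> 1 / 2" and q: "0 < q" "q \<le> 1" and d: "1 \<le> d" and \<delta>: "0 < \<delta>" "\<delta> \<le> 1 / 2"
    "2 * \<delta> * (1 + 1 / q + 1 / (2 * q\<^sup>2) + d / (q * (\<epsilon> * q / 8))) \<le> \<epsilon> / 16"
    and \<delta>': "real T * I = \<delta>'" "\<delta> \<le> \<delta>'" "\<delta>' \<le> 2 * \<delta>" and I: "0 \<le> I"
    and a: "a\<^sup>2 = (1 - \<epsilon> / 2)\<^sup>2 * (2 * d * I)" "cosh a \<le> 1 + \<epsilon> / 4"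
    and G: "G \<le> \<epsilon> * q / 32" and B: "B \<le> \<epsilon> * q / 32 * real T + real T * \<delta>'"
    and \<eta>: "\<eta> = \<epsilon> * q / 8"
  shows "(1 + a\<^sup>2 / (2 * d) * cosh a) ^ T - (I * (real T * (1 - G)) - I / q * B)
     + (real T * I / q)\<^sup>2 / 2 + (real T * I / q) * ((\<eta> + a\<^sup>2 * real T / \<eta>) / 2) \<le> 1 - \<epsilon> * \<delta> / 4"
proof -
  have \<delta>'0: "0 < \<delta>'" "\<delta>' \<le> 1" using \<delta>' \<delta> by linarith+
  have \<eta>0: "0 < \<eta>" unfolding \<eta> using \<epsilon> q by simp
  have a2: "a\<^sup>2 / (2 * d) = (1 - \<epsilon> / 2)\<^sup>2 * I" using a(1) d by simp
  have sq: "(1 - \<epsilon> / 2)\<^sup>2 \<le> 1 - \<epsilon> / 2" "0 \<le> (1 - \<epsilon> / 2)\<^sup>2"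
    using \<epsilon> by (auto simp: power2_eq_square intro!: mult_left_le)
  have growth: "(1 + a\<^sup>2 / (2 * d) * cosh a) ^ T \<le> 1 + (1 - \<epsilon> / 2) * \<delta>' + \<delta>'\<^sup>2"
  proof -
    have "a\<^sup>2 / (2 * d) * cosh a \<le> (1 - \<epsilon> / 2)\<^sup>2 * I * (1 + \<epsilon> / 4)"
      unfolding a2 using I sq by (intro mult_left_mono a(2)) auto
    also have "\<dots> = ((1 - \<epsilon> / 2) * ((1 - \<epsilon> / 2) * (1 + \<epsilon> / 4))) * I"
      by (simp add: power2_eq_square)
    also have "\<dots> \<le> ((1 - \<epsilon> / 2) * 1) * I"
    proof (intro mult_right_mono mult_left_mono I)
      have "(1 - \<epsilon> / 2) * (1 + \<epsilon> / 4) = 1 - \<epsilon> / 4 - \<epsilon>\<^sup>2 / 8" by (simp add: field_simps power2_eq_square)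
      then show "(1 - \<epsilon> / 2) * (1 + \<epsilon> / 4) \<le> 1" using \<epsilon> zero_le_power2[of \<epsilon>] by linarith
    qed (use \<epsilon> in simp)
    finally have k: "a\<^sup>2 / (2 * d) * cosh a \<le> (1 - \<epsilon> / 2) * I" by simp
    have "0 \<le> a\<^sup>2 / (2 * d) * cosh a" using d by (simp add: cosh_real_nonneg)
    then have "(1 + a\<^sup>2 / (2 * d) * cosh a) ^ T \<le> exp ((1 - \<epsilon> / 2) * I) ^ T"
      using k exp_ge_add_one_self[of "(1 - \<epsilon> / 2) * I"] by (intro power_mono) linarith+
    also have "\<dots> = exp ((1 - \<epsilon> / 2) * \<delta>')"
      using \<delta>'(1) by (simp add: exp_of_nat_mult[symmetric] mult_ac)
    also have "\<dots> \<le> 1 + (1 - \<epsilon> / 2) * \<delta>' + ((1 - \<epsilon> / 2) * \<delta>')\<^sup>2"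
      using \<epsilon> \<delta>'0 by (intro exp_bound mult_nonneg_nonneg mult_le_one) auto
    also have "((1 - \<epsilon> / 2) * \<delta>')\<^sup>2 \<le> \<delta>'\<^sup>2"
      using \<epsilon> \<delta>'0 by (intro power_mono mult_left_le_one_le) auto
    finally show ?thesis by simp
  qed
  have "I * (real T * (1 - G)) = \<delta>' * (1 - G)" using \<delta>'(1) by (simp add: mult_ac)
  also have "\<dots> \<ge> \<delta>' * (1 - \<epsilon> / 32)"
  proof (intro mult_left_mono)
    have "\<epsilon> * q / 32 \<le> \<epsilon> / 32" using \<epsilon> q by (simp add: mult_left_le)
    then show "1 - \<epsilon> / 32 \<le> 1 - G" using G by linarith
  qed (use \<delta>'0 in simp)
  finally have kill: "\<delta>' * (1 - \<epsilon> / 32) \<le> I * (real T * (1 - G))" .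
  have "I / q * B \<le> I / q * (\<epsilon> * q / 32 * real T + real T * \<delta>')"
    using I q by (intro mult_left_mono B) auto
  also have "\<dots> = (real T * I) * (\<epsilon> / 32 + \<delta>' / q)"
    using q by (simp add: field_simps)
  finally have bad: "I / q * B \<le> \<delta>' * (\<epsilon> / 32 + \<delta>' / q)" by (simp add: \<delta>'(1))
  have "a\<^sup>2 * real T \<le> 1 * (2 * d * I) * real T"
    unfolding a(1) using sq d I \<epsilon> by (intro mult_right_mono) auto
  also have "\<dots> = 2 * d * \<delta>'" using \<delta>'(1) by (simp add: mult_ac)
  finally have "a\<^sup>2 * real T / \<eta> \<le> 2 * d * \<delta>' / \<eta>"
    using \<eta>0 by (intro divide_right_mono) auto
  then have "(\<eta> + a\<^sup>2 * real T / \<eta>) / 2 \<le> (\<eta> + 2 * d * \<delta>' / \<eta>) / 2"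
    by (rule divide_right_mono[OF add_left_mono]) simp
  then have "(real T * I / q) * ((\<eta> + a\<^sup>2 * real T / \<eta>) / 2) \<le> (\<delta>' / q) * ((\<eta> + 2 * d * \<delta>' / \<eta>) / 2)"
    unfolding \<delta>'(1) by (rule mult_left_mono) (use \<delta>'0 q in simp)
  also have "\<dots> = \<delta>' * (\<epsilon> / 16 + d / (q * \<eta>) * \<delta>')"
    using \<eta> q \<epsilon> by (simp add: field_simps)
  finally have cross: "(real T * I / q) * ((\<eta> + a\<^sup>2 * real T / \<eta>) / 2) \<le> \<delta>' * (\<epsilon> / 16 + d / (q * \<eta>) * \<delta>')" .
  have quad: "(real T * I / q)\<^sup>2 / 2 = \<delta>' * (1 / (2 * q\<^sup>2) * \<delta>')"
    unfolding \<delta>'(1) by (simp add: power2_eq_square)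
  let ?B = "1 + 1 / q + 1 / (2 * q\<^sup>2) + d / (q * \<eta>)"
  have "\<delta>' * ?B \<le> 2 * \<delta> * ?B"
    using \<delta>'(3) q d \<eta>0 by (intro mult_right_mono add_nonneg_nonneg) auto
  then have "\<delta>' * ?B \<le> \<epsilon> / 16" using \<delta>(3)[folded \<eta>] by (rule order_trans)
  then have small: "\<delta>' * (\<delta>' * ?B) \<le> \<delta>' * (\<epsilon> / 16)" using \<delta>'0 by (intro mult_left_mono) auto
  have "(1 + a\<^sup>2 / (2 * d) * cosh a) ^ T - (I * (real T * (1 - G)) - I / q * B)
     + (real T * I / q)\<^sup>2 / 2 + (real T * I / q) * ((\<eta> + a\<^sup>2 * real T / \<eta>) / 2)
     \<le> (1 + (1 - \<epsilon> / 2) * \<delta>' + \<delta>'\<^sup>2) - (\<delta>' * (1 - \<epsilon> / 32) - \<delta>' * (\<epsilon> / 32 + \<delta>' / q))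
      + \<delta>' * (1 / (2 * q\<^sup>2) * \<delta>') + \<delta>' * (\<epsilon> / 16 + d / (q * \<eta>) * \<delta>')"
    using growth kill bad cross quad by linarith
  also have "\<dots> = 1 - \<delta>' * (3 * \<epsilon> / 8) + \<delta>' * (\<delta>' * ?B)"
    by (simp add: algebra_simps power2_eq_square)
  also have "\<dots> \<le> 1 - \<delta>' * (3 * \<epsilon> / 8) + \<delta>' * (\<epsilon> / 16)" using small by linarith
  also have "\<dots> = 1 - \<delta>' * \<epsilon> * (5 / 16)" by simp
  also have "\<dots> \<le> 1 - \<epsilon> * \<delta> / 4"
  proof -
    have "\<delta> * \<epsilon> \<le> \<delta>' * \<epsilon>" using \<delta>'(2) \<epsilon> by (intro mult_right_mono) auto
    moreover have "0 \<le> \<delta> * \<epsilon>" using \<delta> \<epsilon> by simp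
    ultimately show ?thesis by (simp add: mult.commute)
  qed
  finally show ?thesis .
qed

text \<open>
  A bound for the expected time spent in \<open>A\<close>. For sets of size of order \<open>T\<close> it gives \<open>o(T)\<close>, as \<open>\<eta>\<close> is
  arbitrary and the sum on the right is a constant.
\<close>

lemma sum_majorant_le:
  assumes g: "\<And>x :: int ^ 'd::finite. 0 < g x" and \<eta>: "0 < \<eta>" and S: "finite {x. \<eta> \<le> g x}" and A: "finite A"
  shows "(\<Sum>v\<in>A. g (x - v)) \<le> (\<Sum>z | \<eta> \<le> g z. g z) + \<eta> * real (card A)"
proof -
  have "(\<Sum>v\<in>A. g (x - v)) = (\<Sum>z\<in>(\<lambda>v. x - v) ` A. g z)"
    by (subst sum.reindex) (auto simp: inj_on_def)
  also have "\<dots> = (\<Sum>z\<in>(\<lambda>v. x - v) ` A \<inter> {z. \<eta> \<le> g z}. g z) + (\<Sum>z\<in>(\<lambda>v. x - v) ` A - {z. \<eta> \<le> g z}. g z)"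
    using A by (intro sum.Int_Diff) auto
  also have "(\<Sum>z\<in>(\<lambda>v. x - v) ` A \<inter> {z. \<eta> \<le> g z}. g z) \<le> (\<Sum>z | \<eta> \<le> g z. g z)"
    using g by (intro sum_mono2 S) (auto intro: less_imp_le)
  also have "(\<Sum>z\<in>(\<lambda>v. x - v) ` A - {z. \<eta> \<le> g z}. g z) \<le> (\<Sum>z\<in>(\<lambda>v. x - v) ` A - {z. \<eta> \<le> g z}. \<eta>)"
    by (intro sum_mono) auto
  also have "\<dots> \<le> \<eta> * real (card A)"
  proof -
    have "card ((\<lambda>v. x - v) ` A - {z. \<eta> \<le> g z}) \<le> card ((\<lambda>v. x - v) ` A)"
      using A by (intro card_mono) auto
    also have "\<dots> \<le> card A" by (rule card_image_le[OF A])
    finally show ?thesis using \<eta> by (simp add: mult.commute mult_left_mono)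
  qed
  finally show ?thesis by simp
qed

text \<open>
  The order of the choices matters. The slab width \<open>b / sqrt I\<close> and the factor \<open>\<rho>\<close> depend on \<open>\<epsilon>\<close> and \<open>d\<close>, then
  \<open>\<delta>\<close> fixes the gain \<open>\<theta>\<close> per block, then \<open>J\<close> is the number of blocks that compensates \<open>\<rho>\<close>. Only then the
  admissible overlap \<open>\<eta>2\<close> with \<open>J T\<close> charged sites can be fixed, and finally the threshold \<open>r0\<close> for \<open>I\<close>. The
  margin at the boundary of a slab is \<open>R = 1 / sqrt I\<close>; this is large compared with the displacement
  \<open>sqrt (\<delta> / I)\<close> in a block and small compared with the width of a slab.
\<close>

lemma survive_decay:
  fixes g :: "int ^ 'd::finite \<Rightarrow> real" and l :: "real ^ 'd"
  assumes l: "norm l = 1" and \<epsilon>: "0 < \<epsilon>" "\<epsilon> \<le> 1 / 2" and q: "0 < q" "q \<le> 1"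
    and g: "green_majorant g" and gfin: "\<And>\<eta>. 0 < \<eta> \<Longrightarrow> finite {x. \<eta> \<le> g x}"
  obtains C r0 where "0 < C" "0 < r0"
    "\<And>(N :: 'p measure) s m y. annealed N s q g \<Longrightarrow> 0 < annealed.rate N s q \<Longrightarrow> annealed.rate N s q < r0 \<Longrightarrow>
       0 \<le> level l y \<Longrightarrow>
       annealed.survive N s y m [] 0
         \<le> C * exp (- ((1 - \<epsilon>) * sqrt (2 * real CARD('d) * annealed.rate N s q) * level l y))"
proof -
  let ?d = "real CARD('d)"
  have d1: "1 \<le> ?d" using zero_less_card_finite[where 'a = 'd] by linarith
  have g0: "0 < g x" for x using g by (simp add: green_majorant_def)
  define c where "c = sqrt (2 * ?d)"
  have c1: "1 \<le> c" unfolding c_def by (subst real_sqrt_ge_1_iff) (use d1 in linarith)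
  \<comment> \<open>so wide a slab absorbs the two margins and the factor 2 in \<open>cosh u \<ge> exp u / 2\<close>\<close>
  define b where "b = 8 / \<epsilon>"
  have b: "16 \<le> b" "\<epsilon> * b = 8" using \<epsilon> by (simp_all add: b_def pos_le_divide_eq)
  define \<rho> where "\<rho> = exp ((1 - \<epsilon>) * c * b)"
  have \<rho>1: "1 \<le> \<rho>" using \<epsilon> c1 b by (simp add: \<rho>_def)
  define \<eta> where "\<eta> = \<epsilon> * q / 8"
  have \<eta>0: "0 < \<eta>" using \<epsilon> q by (simp add: \<eta>_def)
  define B where "B = 1 + 1 / q + 1 / (2 * q\<^sup>2) + ?d / (q * (\<epsilon> * q / 8))"
  have B: "1 \<le> B" using \<epsilon> q d1 by (simp add: B_def)
  define \<delta> where "\<delta> = \<epsilon> / (32 * B)"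
  have \<delta>: "0 < \<delta>" "\<delta> \<le> 1 / 2" "2 * \<delta> * B \<le> \<epsilon> / 16"
    using \<epsilon> B by (auto simp: \<delta>_def field_simps)
  define \<theta> where "\<theta> = 1 - \<epsilon> * \<delta> / 4"
  have "0 < \<epsilon> * \<delta>" "\<epsilon> * \<delta> \<le> 1 / 2 * (1 / 2)" using \<epsilon> \<delta> mult_mono[of \<epsilon> "1 / 2" \<delta> "1 / 2"] by simp_all
  then have \<theta>: "0 < \<theta>" "\<theta> < 1" by (auto simp: \<theta>_def)
  obtain J where J: "\<theta> ^ J < 1 / \<rho>"
    using real_arch_pow_inv[of "1 / \<rho>" \<theta>] \<theta> \<rho>1 by auto
  have J': "\<theta> ^ J * \<rho> \<le> 1" using J \<rho>1 by (simp add: field_simps)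
  define \<eta>1 where "\<eta>1 = \<epsilon> * q / 32"
  have \<eta>1: "0 < \<eta>1" using \<epsilon> q by (simp add: \<eta>1_def)
  define \<eta>2 where "\<eta>2 = \<eta>1 / (2 * (real J + 1))"
  have \<eta>2: "0 < \<eta>2" using \<eta>1 by (simp add: \<eta>2_def)
  define K where "K = (\<Sum>z | \<eta>2 \<le> g z. g z)"
  have K0: "0 \<le> K" unfolding K_def by (intro sum_nonneg less_imp_le[OF g0])
  obtain a0 where a0: "0 < a0" "\<And>a. 0 \<le> a \<Longrightarrow> a \<le> a0 \<Longrightarrow> cosh a \<le> 1 + \<epsilon> / 4"
    using cosh_near_zero[of "\<epsilon> / 4"] \<epsilon> by auto
  define S where "S = {z. \<eta>1 * g 0 \<le> g z}"
  have S: "finite S" unfolding S_def using \<eta>1 g0[of 0] by (intro gfin) simp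
  define R0 where "R0 = 1 + (\<Sum>z\<in>S. \<bar>level l z\<bar>)"
  have R0: "1 \<le> R0" by (simp add: R0_def sum_nonneg)
  have R0': "\<bar>level l z\<bar> < R0" if "z \<in> S" for z
    using member_le_sum[OF that, of "\<lambda>z. \<bar>level l z\<bar>"] S by (simp add: R0_def)
  define r0 where "r0 = Min {\<delta>, 1, (a0 / c)\<^sup>2, \<delta> * \<eta>1 / (2 * K + 1), 1 / R0\<^sup>2}"
  have r0: "0 < r0" using \<delta> a0 c1 \<eta>1 K0 R0 by (simp add: r0_def)
  show ?thesis
  proof (rule that[of \<rho> r0])
    show "0 < \<rho>" using \<rho>1 by simp
    show "0 < r0" by fact
    fix N :: "'p measure" and s m y
    assume ann: "annealed N s q g" and I0: "0 < annealed.rate N s q" and Ir0: "annealed.rate N s q < r0"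
      and y: "0 \<le> level l y"
    interpret annealed N s q g by (rule ann)
    define I where "I = rate"
    have I: "0 < I" "I \<le> \<delta>" "I \<le> 1" "I \<le> (a0 / c)\<^sup>2" "I \<le> \<delta> * \<eta>1 / (2 * K + 1)" "I \<le> 1 / R0\<^sup>2"
      using I0 Ir0 by (auto simp: I_def r0_def)
    define R where "R = 1 / sqrt I"
    have R: "0 < R" "R\<^sup>2 = 1 / I" using I by (auto simp: R_def power_divide)
    have R1: "1 \<le> R" using I by (simp add: R_def)
    have RR0: "R0 \<le> R"
    proof (rule power2_le_imp_le)
      show "R0\<^sup>2 \<le> R\<^sup>2" using I(1,6) R0 by (simp add: R(2) field_simps)
    qed (use R in simp)
    define T where "T = nat \<lceil>\<delta> / I\<rceil>"
    have T: "\<delta> / I \<le> real T" "real T < \<delta> / I + 1"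
      using \<delta> I unfolding T_def by (simp_all add: of_nat_nat) linarith+
    have T1: "1 \<le> T" using T(1) \<delta>(1) I(1) by (metis One_nat_def Suc_leI divide_pos_pos not_gr_zero not_le of_nat_0)
    define \<delta>' where "\<delta>' = real T * I"
    have \<delta>': "\<delta> \<le> \<delta>'" "\<delta>' \<le> 2 * \<delta>"
    proof -
      show "\<delta> \<le> \<delta>'" using T(1) I(1) by (simp add: \<delta>'_def field_simps)
      have "\<delta>' \<le> (\<delta> / I + 1) * I" unfolding \<delta>'_def using T(2) I(1) by (intro mult_right_mono) auto
      also have "\<dots> = \<delta> + I" using I(1) by (simp add: field_simps)
      finally show "\<delta>' \<le> 2 * \<delta>" using I(2) by simp
    qed
    define a where "a = (1 - \<epsilon> / 2) * (c * sqrt I)"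
    have a_pos: "0 \<le> a" using \<epsilon> c1 I by (simp add: a_def)
    have aR: "a * R = (1 - \<epsilon> / 2) * c" using I by (simp add: a_def R_def)
    have a_sq: "a\<^sup>2 = (1 - \<epsilon> / 2)\<^sup>2 * (2 * ?d * I)"
      using I by (simp add: a_def c_def power_mult_distrib)
    have a_le: "a \<le> a0"
    proof -
      have "sqrt I \<le> a0 / c" using I(4) a0 c1 by (simp add: real_le_lsqrt)
      then have "c * sqrt I \<le> a0" using c1 by (simp add: field_simps)
      moreover have "a \<le> 1 * (c * sqrt I)" unfolding a_def using \<epsilon> c1 I by (intro mult_right_mono) auto
      ultimately show ?thesis by simp
    qed
    define L where "L = b * R"
    have L: "16 * R \<le> L" using b R by (simp add: L_def)
    then have L0: "0 < L" using R by linarith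
    define k where "k = nat \<lfloor>level l y / L\<rfloor>"
    have k: "real k * L \<le> level l y" "level l y < (real k + 1) * L"
    proof -
      have "0 \<le> level l y / L" using y L0 by simp
      then have "real k \<le> level l y / L" "level l y / L < real k + 1"
        by (simp_all add: k_def of_nat_nat)
      then show "real k * L \<le> level l y" "level l y < (real k + 1) * L"
        using L0 by (simp_all add: field_simps)
    qed
    have \<rho>_cosh: "\<rho> \<le> cosh (a * (L - 2 * R - 1))"
    proof -
      have "(1 - \<epsilon>) * c * b + 1 \<le> a * R * (b - 3)"
      proof -
        have "a * R * (b - 3) - (1 - \<epsilon>) * c * b = c * (\<epsilon> * b) / 2 - 3 * c + 3 * \<epsilon> * c / 2"
          unfolding aR by (simp add: field_simps)
        also have "\<dots> = c + 3 * \<epsilon> * c / 2" using b(2) by simp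
        also have "\<dots> \<ge> 1" using c1 \<epsilon> by (simp add: add_increasing2)
        finally show ?thesis by simp
      qed
      also have "\<dots> = a * (b * R - 3 * R)" by (simp add: algebra_simps)
      also have "\<dots> \<le> a * (L - 2 * R - 1)" using R1 a_pos by (intro mult_left_mono) (auto simp: L_def)
      finally have u: "(1 - \<epsilon>) * c * b + 1 \<le> a * (L - 2 * R - 1)" .
      have "2 * \<rho> \<le> exp 1 * \<rho>" using exp_ge_add_one_self[of 1] \<rho>1 by (intro mult_right_mono) auto
      also have "\<dots> = exp ((1 - \<epsilon>) * c * b + 1)" by (simp add: \<rho>_def exp_add mult.commute)
      also have "\<dots> \<le> exp (a * (L - 2 * R - 1))" using u by simp
      also have "\<dots> \<le> 2 * cosh (a * (L - 2 * R - 1))" by (simp add: cosh_field_def)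
      finally show ?thesis by simp
    qed
    have "survive y m [] 0 \<le> (1 / \<rho>) ^ k"
    proof (rule survive_slabs[OF l a_pos T1, of \<theta> \<rho> J L R k])
      fix i :: nat and x :: "int ^ 'd" and A :: "(int ^ 'd) set"
      assume i: "i < k" and A: "finite A" "card A \<le> J * T"
        and x: "real i * L + R < level l x" "level l x < real (Suc i) * L - R"
      let ?D = "{v. real i * L < level l v \<and> level l v \<le> real (Suc i) * L} - A"
      let ?m = "real i * L + R + 1"
      let ?B = "(\<Sum>v\<in>A. g (x - v)) + (real T)\<^sup>2 / R\<^sup>2"
      have D: "v \<in> A \<or> R \<le> \<bar>level l v - level l x\<bar>" if "v \<notin> ?D" for v
        using that x by (auto simp: not_less not_le)
      have "(\<Sum>v\<in>A. g (x - v)) \<le> K + \<eta>2 * real (card A)"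
        unfolding K_def using g0 \<eta>2 by (intro sum_majorant_le gfin A)
      also have "\<dots> \<le> K + \<eta>2 * (real J * real T)"
        using A(2) \<eta>2 by (intro add_left_mono mult_left_mono) (auto simp flip: of_nat_mult)
      also have "K \<le> \<eta>1 / 2 * real T"
      proof -
        have "I * (2 * K + 1) \<le> \<delta> * \<eta>1" using I(5) K0 by (simp add: field_simps)
        then have "I * (2 * K) \<le> \<delta> * \<eta>1" using I(1) by (simp add: distrib_left)
        also have "\<dots> \<le> \<delta>' * \<eta>1" using \<delta>'(1) \<eta>1 by (intro mult_right_mono) auto
        also have "\<dots> = I * (\<eta>1 * real T)" by (simp add: \<delta>'_def)
        finally show ?thesis using I(1) by simp
      qed
      also have "\<eta>2 * (real J * real T) \<le> \<eta>1 / 2 * real T"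
      proof -
        have "\<eta>2 * real J \<le> \<eta>2 * (real J + 1)" using \<eta>2 by simp
        also have "\<dots> = \<eta>1 / 2"
        proof -
          have "real J + 1 \<noteq> 0" by linarith
          then show ?thesis unfolding \<eta>2_def by (simp only: times_divide_eq_left nonzero_mult_divide_mult_cancel_right2) (simp add: divide_simps)
        qed
        finally have "\<eta>2 * real J * real T \<le> \<eta>1 / 2 * real T" by (intro mult_right_mono) auto
        then show ?thesis by (simp add: mult.assoc)
      qed
      finally have "(\<Sum>v\<in>A. g (x - v)) \<le> \<eta>1 * real T" by simp
      moreover have "(real T)\<^sup>2 / R\<^sup>2 = real T * \<delta>'"
        unfolding R(2) \<delta>'_def using I(1) by (simp add: power2_eq_square)
      ultimately have Bbound: "?B \<le> \<epsilon> * q / 32 * real T + real T * \<delta>'"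
        by (simp add: \<eta>1_def)
      have G: "g (x - y) / g 0 \<le> \<epsilon> * q / 32"
      proof (rule ccontr)
        assume "\<not> ?thesis"
        then have "\<epsilon> * q / 32 * g 0 < g (x - y)"
          unfolding not_le pos_less_divide_eq[OF g0] .
        then have "x - y \<in> S" by (simp add: S_def \<eta>1_def)
        then have "\<bar>level l (x - y)\<bar> < R0" by (rule R0')
        moreover have "level l (x - y) = level l x - level l y"
          using level_add[of l "x - y" y] by simp
        moreover have "real (Suc i) * L \<le> real k * L" using i L0 by (intro mult_right_mono) auto
        ultimately show False using x(2) k(1) RR0 by linarith
      qed
      have "walkE y T x (\<lambda>b z. weight phi ?D b * ramp a (level l z - ?m)) \<le>
        ((1 + a\<^sup>2 / (2 * ?d) * cosh a) ^ T
          - (rate * (real T * (1 - g (x - y) / g 0)) - rate / q * ?B)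
          + (real T * rate / q)\<^sup>2 / 2 + (real T * rate / q) * ((\<eta> + a\<^sup>2 * real T / \<eta>) / 2))
         * ramp a (level l x - ?m)"
        by (rule block_estimate[OF l a_pos \<eta>0 A(1) R(1) D])
      also have "\<dots> \<le> \<theta> * ramp a (level l x - ?m)"
        unfolding I_def[symmetric] \<theta>_def
        by (intro mult_right_mono block_factor_bound[where \<delta>' = \<delta>' and d = ?d] \<epsilon> q d1 \<delta>(1,2) \<delta>(3)[unfolded B_def]
              \<delta>'_def[symmetric] \<delta>' a_sq a0(2)[OF a_pos a_le] G Bbound \<eta>_def order_trans[OF zero_le_one ramp_ge_1])
           (use I in simp)
      finally show "walkE y T x (\<lambda>b z. weight phi ?D b * ramp a (level l z - ?m)) \<le> \<theta> * ramp a (level l x - ?m)" .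
    qed (use \<theta> \<rho>1 J' \<rho>_cosh R R1 L k in auto)
    also have "\<dots> = exp (- ((1 - \<epsilon>) * c * b * real k))"
      by (simp add: \<rho>_def power_divide exp_minus inverse_eq_divide exp_of_nat_mult[symmetric] mult.commute)
    also have "\<dots> \<le> exp ((1 - \<epsilon>) * c * b - (1 - \<epsilon>) * c * sqrt I * level l y)"
    proof -
      have "sqrt I * level l y \<le> sqrt I * ((real k + 1) * L)" using k(2) I(1) by (intro mult_left_mono) auto
      also have "\<dots> = (real k + 1) * b" using I(1) by (simp add: L_def R_def)
      finally have "((1 - \<epsilon>) * c) * (sqrt I * level l y) \<le> ((1 - \<epsilon>) * c) * ((real k + 1) * b)"
        using \<epsilon> c1 by (intro mult_left_mono) auto
      then show ?thesis by (simp add: algebra_simps)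
    qed
    also have "\<dots> = \<rho> * exp (- ((1 - \<epsilon>) * sqrt (2 * ?d * rate) * level l y))"
    proof -
      have "sqrt (2 * ?d * rate) = c * sqrt I" by (simp add: c_def I_def real_sqrt_mult)
      then show ?thesis by (simp add: \<rho>_def exp_add[symmetric] mult.assoc)
    qed
    finally show "survive y m [] 0 \<le> \<rho> * exp (- ((1 - \<epsilon>) * sqrt (2 * ?d * rate) * level l y))" .
  qed
qed

section \<open>The survival factor of the potential\<close>

text \<open>
  Truncating \<open>z\<close> at 0 makes the survival factor a probability everywhere, not just almost everywhere.
\<close>

definition surv :: "real \<Rightarrow> real \<Rightarrow> real" where
  "surv \<beta> z = 1 / (1 + \<beta> * max 0 z)"

lemma surv_range: "0 \<le> \<beta> \<Longrightarrow> 0 \<le> surv \<beta> z" "0 \<le> \<beta> \<Longrightarrow> surv \<beta> z \<le> 1" "0 \<le> \<beta> \<Longrightarrow> 0 < surv \<beta> z"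
  by (auto simp: surv_def divide_le_eq add_pos_nonneg)

lemma measurable_surv [measurable]: "surv \<beta> \<in> borel_measurable borel"
  unfolding surv_def[abs_def] by measurable

lemma exp_V_beta:
  assumes "0 < \<beta>" "0 \<le> z"
  shows "exp (- (\<beta> * V_beta \<beta> z)) = surv \<beta> z"
proof -
  have "0 < \<beta> * z + 1" using assms by (simp add: add_nonneg_pos)
  then show ?thesis
    using assms by (simp add: V_beta_def surv_def exp_minus inverse_eq_divide max_def add.commute)
qed

lemma f_escape_eq_kill_fun: "f_escape q z = kill_fun q (exp (- z))"
  by (simp add: f_escape_def kill_fun_def)

lemma I_bar_eq_rate:
  assumes \<mu>: "sets \<mu> = sets borel" "AE z in \<mu>. 0 \<le> z" and \<beta>: "0 < \<beta>"
  shows "I_bar TYPE('d::finite) \<mu> \<beta> = (\<integral>z. kill_fun (escape_prob TYPE('d)) (surv \<beta> z) \<partial>\<mu>)"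
proof -
  let ?q = "escape_prob TYPE('d)"
  have [measurable]: "V_beta \<beta> \<in> borel_measurable \<mu>" "f_escape ?q \<in> borel_measurable borel"
    "kill_fun ?q \<in> borel_measurable borel" "surv \<beta> \<in> borel_measurable \<mu>"
    using \<mu>(1) unfolding V_beta_def[abs_def] f_escape_def[abs_def] kill_fun_def[abs_def]
    by (simp_all cong: measurable_cong_sets)
  have [measurable]: "(\<lambda>z. z) \<in> borel_measurable \<mu>" using \<mu>(1) by (simp cong: measurable_cong_sets)
  have "I_bar TYPE('d) \<mu> \<beta> = (\<integral>z. f_escape ?q (\<beta> * V_beta \<beta> z) \<partial>\<mu>)"
    unfolding I_bar_def mu_beta_def by (rule integral_distr) measurable
  also have "\<dots> = (\<integral>z. kill_fun ?q (surv \<beta> z) \<partial>\<mu>)"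
    using \<mu>(2) \<beta>
    by (intro integral_cong_AE) (auto elim!: eventually_mono simp: f_escape_eq_kill_fun exp_V_beta)
  finally show ?thesis .
qed

lemma prod_list_eq_prod_count:
  fixes f :: "'a \<Rightarrow> real"
  shows "prod_list (map f p) = (\<Prod>x\<in>set p. f x ^ count_list p x)"
proof (induction p)
  case (Cons a p)
  have "(\<Prod>x\<in>set (a # p). f x ^ count_list (a # p) x)
      = f a ^ count_list (a # p) a * (\<Prod>x\<in>set (a # p) - {a}. f x ^ count_list (a # p) x)"
    by (rule prod.remove) auto
  also have "(\<Prod>x\<in>set (a # p) - {a}. f x ^ count_list (a # p) x) = (\<Prod>x\<in>set p - {a}. f x ^ count_list p x)"
    by (rule prod.cong) auto
  also have "f a ^ count_list (a # p) a * (\<Prod>x\<in>set p - {a}. f x ^ count_list p x)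
      = f a * (\<Prod>x\<in>set p. f x ^ count_list p x)"
    by (cases "a \<in> set p") (simp_all add: prod.remove[of "set p" a] count_notin)
  finally show ?case using Cons by simp
qed simp

lemma exp_neg_sum_visits:
  fixes w :: "int ^ 'd::finite \<Rightarrow> real"
  assumes "0 < \<beta>" "\<And>x. 0 \<le> w x"
  shows "exp (- (\<Sum>k=0..n. \<beta> * V_beta \<beta> (w (S k))))
    = (\<Prod>x\<in>set (map S [0..<Suc n]). surv \<beta> (w x) ^ count_list (map S [0..<Suc n]) x)"
proof -
  have "exp (- (\<Sum>k=0..n. \<beta> * V_beta \<beta> (w (S k)))) = (\<Prod>k=0..n. surv \<beta> (w (S k)))"
    by (simp add: sum_negf[symmetric] exp_sum exp_V_beta[OF assms(1) assms(2)])
  also have "\<dots> = prod_list (map (\<lambda>x. surv \<beta> (w x)) (map S [0..<Suc n]))"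
  proof (induction n)
    case (Suc n)
    then show ?case by (simp add: mult.commute)
  qed simp
  finally show ?thesis by (simp only: prod_list_eq_prod_count)
qed

lemma expected_green_le:
  fixes V :: "int ^ 'd::finite \<Rightarrow> 'w \<Rightarrow> real" and g :: "int ^ 'd \<Rightarrow> real"
  assumes M: "prob_space M" and indep: "prob_space.indep_vars M (\<lambda>_. borel) V UNIV"
    and distr: "\<And>x. distr M borel (V x) = \<mu>" and pos: "AE z in \<mu>. 0 \<le> z" and \<beta>: "0 < \<beta>"
    and ann: "annealed \<mu> (surv \<beta>) q g"
    and bound: "\<And>m. annealed.survive \<mu> (surv \<beta>) y m [] 0 \<le> c"
  shows "(\<integral>\<^sup>+ \<omega>. green \<beta> (\<lambda>x. V x \<omega>) 0 y \<partial>M) \<le> ennreal (g 0 * c)"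
proof -
  interpret M: prob_space M by (rule M)
  interpret annealed \<mu> "surv \<beta>" q g by (rule ann)
  have V [measurable]: "V x \<in> borel_measurable M" for x
    using indep by (auto simp: M.indep_vars_def)
  define F where "F = (\<lambda>\<omega> (p :: (int ^ 'd) list) z.
    if z = y then \<Prod>x\<in>set p. surv \<beta> (V x \<omega>) ^ count_list p x else 0)"
  define G where "G = (\<lambda>(p :: (int ^ 'd) list) z. if z = y then weight phi UNIV p else 0)"
  have F0: "0 \<le> F \<omega> p z" for \<omega> p z
    using surv_range \<beta> by (auto simp: F_def intro!: prod_nonneg)
  have Fm: "(\<lambda>\<omega>. F \<omega> p z) \<in> borel_measurable M" for p z
    unfolding F_def by measurable
  have one: "(\<integral>\<^sup>+ \<omega>. ennreal (surv \<beta> (V x \<omega>) ^ k) \<partial>M) = ennreal (phi k)" for x k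
  proof -
    have "(\<integral>\<^sup>+ \<omega>. ennreal (surv \<beta> (V x \<omega>) ^ k) \<partial>M) = (\<integral>\<^sup>+ z. ennreal (surv \<beta> z ^ k) \<partial>distr M borel (V x))"
      by (subst nn_integral_distr) auto
    also have "\<dots> = ennreal (phi k)"
      unfolding distr phi_def using surv_range(1) \<beta>
      by (intro nn_integral_eq_integral integrable_power) auto
    finally show ?thesis .
  qed
  have FG: "(\<integral>\<^sup>+ \<omega>. ennreal (F \<omega> p z) \<partial>M) = ennreal (G p z)" for p z
  proof (cases "z = y")
    case True
    have ind: "M.indep_vars (\<lambda>_. borel) (\<lambda>x \<omega>. ennreal (surv \<beta> (V x \<omega>) ^ count_list p x)) (set p)"
      by (rule M.indep_vars_compose2[OF M.indep_vars_subset[OF indep]]) auto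
    have "(\<integral>\<^sup>+ \<omega>. ennreal (F \<omega> p z) \<partial>M) = (\<integral>\<^sup>+ \<omega>. (\<Prod>x\<in>set p. ennreal (surv \<beta> (V x \<omega>) ^ count_list p x)) \<partial>M)"
      using True surv_range(1) \<beta> by (simp add: F_def prod_ennreal)
    also have "\<dots> = (\<Prod>x\<in>set p. \<integral>\<^sup>+ \<omega>. ennreal (surv \<beta> (V x \<omega>) ^ count_list p x) \<partial>M)"
      by (rule M.indep_vars_nn_integral[OF _ ind]) auto
    also have "\<dots> = ennreal (G p z)"
      using True phi_nonneg by (simp add: one G_def weight_def prod_ennreal)
    finally show ?thesis .
  qed (simp add: F_def G_def)
  have G0: "0 \<le> G p z" for p z by (simp add: G_def weight_range)
  have path: "(\<lambda>\<omega>. pathE n x (F \<omega>)) \<in> borel_measurable M"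
    "(\<integral>\<^sup>+ \<omega>. ennreal (pathE n x (F \<omega>)) \<partial>M) = ennreal (pathE n x G)" for n x
    using nn_integral_pathE[of F M G n x] F0 Fm FG G0 by auto
  have "AE \<omega> in M. 0 \<le> V x \<omega>" for x
    using pos unfolding distr[of x, symmetric] by (subst (asm) AE_distr_iff) auto
  then have "AE \<omega> in M. \<forall>x. 0 \<le> V x \<omega>" by (subst AE_all_countable) auto
  then have "AE \<omega> in M. green \<beta> (\<lambda>x. V x \<omega>) 0 y = (\<Sum>n. ennreal (pathE n 0 (F \<omega>)))"
  proof eventually_elim
    case (elim \<omega>)
    have "(\<integral>\<^sup>+ S. ennreal (exp (- (\<Sum>k=0..n. \<beta> * V_beta \<beta> (V (S k) \<omega>)))) * indicator {S. S n = y} S \<partial>srw_law 0)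
        = ennreal (pathE n 0 (F \<omega>))" for n
    proof -
      have "(\<integral>\<^sup>+ S. ennreal (exp (- (\<Sum>k=0..n. \<beta> * V_beta \<beta> (V (S k) \<omega>)))) * indicator {S. S n = y} S \<partial>srw_law 0)
        = (\<integral>\<^sup>+ S. ennreal (F \<omega> (map S [0..<Suc n]) (S n)) \<partial>srw_law 0)"
        using exp_neg_sum_visits[OF \<beta>, of "\<lambda>x. V x \<omega>" _ n] elim
        by (intro nn_integral_cong) (simp add: F_def indicator_def del: upt_Suc)
      then show ?thesis using nn_integral_srw_pathE[of "F \<omega>"] F0 by simp
    qed
    then show ?case unfolding green_def by simp
  qed
  then have "(\<integral>\<^sup>+ \<omega>. green \<beta> (\<lambda>x. V x \<omega>) 0 y \<partial>M) = (\<integral>\<^sup>+ \<omega>. (\<Sum>n. ennreal (pathE n 0 (F \<omega>))) \<partial>M)"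
    by (rule nn_integral_cong_AE)
  also have "\<dots> = (\<Sum>n. \<integral>\<^sup>+ \<omega>. ennreal (pathE n 0 (F \<omega>)) \<partial>M)"
    using path by (intro nn_integral_suminf) auto
  also have "\<dots> = (\<Sum>n. ennreal (pathE n 0 G))" using path by simp
  also have "\<dots> = (SUP m. \<Sum>n<m. ennreal (pathE n 0 G))" by (rule suminf_eq_SUP)
  also have "\<dots> \<le> ennreal (g 0 * c)"
  proof (rule SUP_least)
    fix m
    have "(\<Sum>n<m. ennreal (pathE n 0 G)) \<le> (\<Sum>n\<le>m. ennreal (pathE n 0 G))"
      by (intro sum_mono2) auto
    also have "\<dots> = ennreal (\<Sum>n\<le>m. pathE n 0 G)"
      using G0 by (intro sum_ennreal pathE_nonneg)
    also have "(\<Sum>n\<le>m. pathE n 0 G) = green_upto y m [] 0"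
      using sum_pathE[of 0 y "[]" m] unfolding G_def append_Nil .
    also have "\<dots> \<le> g 0 * c"
      by (rule order_trans[OF green_upto_le_survive mult_left_mono[OF bound less_imp_le[OF g_pos]]])
    finally show "(\<Sum>n<m. ennreal (pathE n 0 G)) \<le> ennreal (g 0 * c)" by (simp add: ennreal_leI)
  qed
  finally show ?thesis .
qed

text \<open>
  Dominated convergence. The integrand is at most 1, and \<open>surv \<beta> z\<close> tends to 1 for each \<open>z\<close>.
\<close>

lemma rate_tendsto_0:
  assumes \<mu>: "prob_space \<mu>" "sets \<mu> = sets borel" and q: "0 < q" "q \<le> 1"
  shows "((\<lambda>\<beta>. \<integral>z. kill_fun q (surv \<beta> z) \<partial>\<mu>) \<longlongrightarrow> 0) (at_right 0)"
proof -
  interpret prob_space \<mu> by fact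
  have [measurable]: "kill_fun q \<in> borel_measurable borel" "surv \<beta> \<in> borel_measurable \<mu>" for \<beta>
    using \<mu>(2) unfolding kill_fun_def[abs_def] by (simp_all cong: measurable_cong_sets)
  have lim: "((\<lambda>t. \<integral>z. kill_fun q (surv (inverse t) z) \<partial>\<mu>) \<longlongrightarrow> (\<integral>z. 0 \<partial>\<mu>)) at_top"
  proof (rule integral_dominated_convergence_at_top[where w = "\<lambda>_. 1"])
    show "\<forall>\<^sub>F t in at_top. AE z in \<mu>. norm (kill_fun q (surv (inverse t) z)) \<le> 1"
      using eventually_gt_at_top[of 0]
    proof eventually_elim
      case (elim t)
      have "norm (kill_fun q (surv (inverse t) z)) \<le> 1" for z
      proof -
        define s where "s = surv (inverse t) z"
        have s: "0 \<le> s" "s \<le> 1" using surv_range elim by (auto simp: s_def)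
        have "0 \<le> (1 - q) * (1 - s) + q * s" "(1 - q) * s \<le> 1 - q" using s q by (auto intro: mult_left_le)
        then have "0 < 1 - (1 - q) * s" "q * (1 - s) \<le> 1 - (1 - q) * s" using q by (auto simp: algebra_simps)
        then show ?thesis using s q by (simp add: s_def[symmetric] kill_fun_def)
      qed
      then show ?case by simp
    qed
    show "AE z in \<mu>. ((\<lambda>t. kill_fun q (surv (inverse t) z)) \<longlongrightarrow> 0) at_top"
    proof (rule AE_I2)
      fix z
      have "((\<lambda>t. kill_fun q (1 / (1 + inverse t * max 0 z))) \<longlongrightarrow> kill_fun q (1 / (1 + 0 * max 0 z))) at_top"
        unfolding kill_fun_def using q
        by (intro tendsto_intros tendsto_inverse_0_at_top filterlim_ident) auto
      then show "((\<lambda>t. kill_fun q (surv (inverse t) z)) \<longlongrightarrow> 0) at_top"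
        by (simp add: surv_def kill_fun_def)
    qed
  qed auto
  show ?thesis
    unfolding filterlim_at_right_to_top using lim by simp
qed

lemma rate_pos:
  assumes \<mu>: "prob_space \<mu>" "sets \<mu> = sets borel" "AE z in \<mu>. 0 \<le> z" and q: "0 < q" "q \<le> 1" and \<beta>: "0 < \<beta>"
    and mass: "(\<integral>\<^sup>+ z. ennreal z \<partial>\<mu>) \<noteq> 0" and ann: "annealed \<mu> (surv \<beta>) q (g :: int ^ 'd::finite \<Rightarrow> real)"
  shows "0 < (\<integral>z. kill_fun q (surv \<beta> z) \<partial>\<mu>)"
proof -
  interpret annealed \<mu> "surv \<beta>" q g by (rule ann)
  have "(\<integral>z. kill_fun q (surv \<beta> z) \<partial>\<mu>) \<noteq> 0"
  proof
    assume "(\<integral>z. kill_fun q (surv \<beta> z) \<partial>\<mu>) = 0"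
    then have "AE z in \<mu>. kill_fun q (surv \<beta> z) = 0"
      using integral_nonneg_eq_0_iff_AE[OF integrable_kill_fun] kill_fun_bounds(3)[OF s_range] by auto
    then have "AE z in \<mu>. ennreal z = 0"
    proof eventually_elim
      case (elim z)
      have "q * (1 - surv \<beta> z) \<le> 0" using kill_fun_bounds(1)[OF s_range, of z] elim by simp
      then have "1 \<le> surv \<beta> z" using q(1) by (simp add: mult_le_0_iff)
      then have "\<beta> * max 0 z \<le> 0" using \<beta> by (simp add: surv_def le_divide_eq add_pos_nonneg split: if_splits)
      then show ?case using \<beta> by (simp add: mult_le_0_iff ennreal_eq_0_iff)
    qed
    then have "(\<integral>\<^sup>+ z. ennreal z \<partial>\<mu>) = (\<integral>\<^sup>+ z. 0 \<partial>\<mu>)" by (rule nn_integral_cong_AE)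
    with mass show False by simp
  qed
  then show ?thesis using rate_nonneg unfolding rate_def by linarith
qed

section \<open>Decay of the averaged Green function\<close>

theorem mainTheorem2:
  fixes l :: "real ^ 'd::finite"
    and \<mu> :: "real measure"
    and M :: "'w measure"
    and V :: "int ^ 'd \<Rightarrow> 'w \<Rightarrow> real"
  assumes "CARD('d) \<ge> 3"
    and "norm l = 1"
    and "prob_space M"
    and "prob_space.indep_vars M (\<lambda>_. borel) V UNIV"
    and "\<And>x. distr M borel (V x) = \<mu>"
    and "AE z in \<mu>. 0 \<le> z"
    and "(\<integral>\<^sup>+ \<omega>. ennreal (V 0 \<omega>) \<partial>M) = \<infinity>"
  shows "\<forall>\<epsilon>>0. \<exists>C>0. \<forall>\<^sub>F \<beta> in at_right 0.
    \<forall>(n::nat) (y :: int ^ 'd). lattice_vec y = real n *\<^sub>R l \<longrightarrow>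
      (\<integral>\<^sup>+ \<omega>. green \<beta> (\<lambda>x. V x \<omega>) 0 y \<partial>M)
        \<le> ennreal (C * exp (- ((1 - \<epsilon>) * sqrt (2 * real CARD('d) * I_bar TYPE('d) \<mu> \<beta>) * real n)))"
proof (intro allI impI)
  fix \<epsilon> :: real assume \<epsilon>: "0 < \<epsilon>"
  interpret M: prob_space M by fact
  obtain g :: "int ^ 'd \<Rightarrow> real" where g: "green_majorant g"
    and gfin: "\<And>\<eta>. 0 < \<eta> \<Longrightarrow> finite {x. \<eta> \<le> g x}"
    using green_majorant_exists[OF assms(1)] by blast
  have gpos: "0 < g x" for x using g by (simp add: green_majorant_def)
  define q where "q = escape_prob TYPE('d)"
  have q: "0 < q" "q \<le> 1" "\<And>n. step_avg (\<lambda>e :: int ^ 'd. hit_prob n e) \<le> 1 - q"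
    unfolding q_def by (rule escape_prob_bounds[OF g])+
  have V0: "V 0 \<in> borel_measurable M" using assms(4) by (auto simp: M.indep_vars_def)
  have sets: "sets \<mu> = sets borel" using assms(5)[of 0] by auto
  have prob: "prob_space \<mu>" using M.prob_space_distr[OF V0] assms(5)[of 0] by simp
  have mass: "(\<integral>\<^sup>+ z. ennreal z \<partial>\<mu>) \<noteq> 0"
    unfolding assms(5)[of 0, symmetric] using V0 assms(7) by (subst nn_integral_distr) auto
  have ann: "annealed \<mu> (surv \<beta>) q g" if "0 < \<beta>" for \<beta>
  proof -
    have "surv \<beta> \<in> borel_measurable \<mu>" using sets by (simp cong: measurable_cong_sets)
    then show ?thesis
      using prob q g surv_range that by (intro annealed.intro annealed_axioms.intro) auto
  qed
  have rate: "annealed.rate \<mu> (surv \<beta>) q = I_bar TYPE('d) \<mu> \<beta>" if "0 < \<beta>" for \<beta>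
    using annealed.rate_def[OF ann[OF that]] I_bar_eq_rate[OF sets assms(6) that, where 'd = 'd]
    by (simp add: q_def)
  \<comment> \<open>a smaller \<open>\<epsilon>\<close> makes the claim stronger\<close>
  define \<epsilon>' where "\<epsilon>' = min \<epsilon> (1 / 2)"
  have \<epsilon>': "0 < \<epsilon>'" "\<epsilon>' \<le> 1 / 2" "\<epsilon>' \<le> \<epsilon>" using \<epsilon> by (auto simp: \<epsilon>'_def)
  obtain C r0 where C: "0 < C" "0 < r0"
    "\<And>(N :: real measure) s m y. annealed N s q g \<Longrightarrow> 0 < annealed.rate N s q \<Longrightarrow> annealed.rate N s q < r0 \<Longrightarrow>
       0 \<le> level l y \<Longrightarrow>
       annealed.survive N s y m [] 0
         \<le> C * exp (- ((1 - \<epsilon>') * sqrt (2 * real CARD('d) * annealed.rate N s q) * level l y))"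
    using survive_decay[OF assms(2) \<epsilon>'(1,2) q(1,2) g gfin, where 'p = real] by blast
  have lim: "((\<lambda>\<beta>. \<integral>z. kill_fun q (surv \<beta> z) \<partial>\<mu>) \<longlongrightarrow> 0) (at_right 0)"
    by (rule rate_tendsto_0[OF prob sets q(1,2)])
  have small: "\<forall>\<^sub>F \<beta> in at_right 0. (\<integral>z. kill_fun q (surv \<beta> z) \<partial>\<mu>) < r0"
    using lim C(2) by (rule order_tendstoD(2))
  have "\<forall>\<^sub>F \<beta> in at_right 0. \<forall>(n::nat) (y :: int ^ 'd). lattice_vec y = real n *\<^sub>R l \<longrightarrow>
      (\<integral>\<^sup>+ \<omega>. green \<beta> (\<lambda>x. V x \<omega>) 0 y \<partial>M)
        \<le> ennreal ((g 0 * C) * exp (- ((1 - \<epsilon>) * sqrt (2 * real CARD('d) * I_bar TYPE('d) \<mu> \<beta>) * real n)))"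
    using small eventually_at_right_less[of 0]
  proof eventually_elim
    case (elim \<beta>)
    show ?case
    proof (intro allI impI)
      fix n :: nat and y :: "int ^ 'd"
      assume y: "lattice_vec y = real n *\<^sub>R l"
      let ?I = "I_bar TYPE('d) \<mu> \<beta>"
      have level: "level l y = real n"
        using y assms(2) by (simp add: level_def norm_eq_1)
      have I: "annealed.rate \<mu> (surv \<beta>) q = (\<integral>z. kill_fun q (surv \<beta> z) \<partial>\<mu>)"
        by (rule annealed.rate_def[OF ann[OF elim(2)]])
      have I0: "0 < annealed.rate \<mu> (surv \<beta>) q"
        unfolding I by (rule rate_pos[OF prob sets assms(6) q(1,2) elim(2) mass ann[OF elim(2)]])
      have "annealed.survive \<mu> (surv \<beta>) y m [] 0
          \<le> C * exp (- ((1 - \<epsilon>') * sqrt (2 * real CARD('d) * ?I) * real n))" for m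
        using C(3)[OF ann[OF elim(2)] I0, of y m] elim(1) by (simp add: I[symmetric] level rate[OF elim(2)])
      from expected_green_le[OF assms(3-6) elim(2) ann[OF elim(2)] this]
      have "(\<integral>\<^sup>+ \<omega>. green \<beta> (\<lambda>x. V x \<omega>) 0 y \<partial>M)
        \<le> ennreal (g 0 * (C * exp (- ((1 - \<epsilon>') * sqrt (2 * real CARD('d) * ?I) * real n))))" .
      also have "\<dots> \<le> ennreal ((g 0 * C) * exp (- ((1 - \<epsilon>) * sqrt (2 * real CARD('d) * ?I) * real n)))"
      proof (rule ennreal_leI)
        have "0 \<le> ?I" using I0 rate[OF elim(2)] by simp
        then have "(1 - \<epsilon>) * sqrt (2 * real CARD('d) * ?I) * real n \<le> (1 - \<epsilon>') * sqrt (2 * real CARD('d) * ?I) * real n"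
          using \<epsilon>'(3) by (intro mult_right_mono) auto
        then show "g 0 * (C * exp (- ((1 - \<epsilon>') * sqrt (2 * real CARD('d) * ?I) * real n)))
          \<le> (g 0 * C) * exp (- ((1 - \<epsilon>) * sqrt (2 * real CARD('d) * ?I) * real n))"
          unfolding mult.assoc using gpos[of 0] C(1) by (intro mult_left_mono) auto
      qed
      finally show "(\<integral>\<^sup>+ \<omega>. green \<beta> (\<lambda>x. V x \<omega>) 0 y \<partial>M)
        \<le> ennreal ((g 0 * C) * exp (- ((1 - \<epsilon>) * sqrt (2 * real CARD('d) * ?I) * real n)))" .
    qed
  qed
  then show "\<exists>C>0. \<forall>\<^sub>F \<beta> in at_right 0.
    \<forall>(n::nat) (y :: int ^ 'd). lattice_vec y = real n *\<^sub>R l \<longrightarrow>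
      (\<integral>\<^sup>+ \<omega>. green \<beta> (\<lambda>x. V x \<omega>) 0 y \<partial>M)
        \<le> ennreal (C * exp (- ((1 - \<epsilon>) * sqrt (2 * real CARD('d) * I_bar TYPE('d) \<mu> \<beta>) * real n)))"
    using gpos[of 0] C(1) by (intro exI[of _ "g 0 * C"]) auto
qed

end
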